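(* Let $\Omega\subset\mathbb{R}^D$ be a $d$-rectifiable set and let $P$ be a probability measure on $\Omega$ with density $p$ with respect to $\mathcal{H}^d$. Let $X_1,X_2,\ldots$ be i.i.d. with law $P$. Assume: (A.1) $K:[0,\infty)\to\mathbb{R}$ is continuous, vanishes outside $[0,1]$, and $\int_{\mathbb{R}^d}K(\|u\|)\,du=1$; (A.2) there is a fixed $m>0$ such that for $\mathcal{H}^d$-almost every $x\in\Omega$, $\Omega$ has an approximate tangent space $T_x\Omega$ with respect to $p$ at $x$ satisfying, for every continuous compactly supported $f:\mathbb{R}^D\to\mathbb{R}$, $$\int_{(\Omega-x)/h}f(y)\,p(x+hy)\,d\mathcal{H}^d(y)=p(x)\int_{T_x\Omega}f(y)\,d\mathcal{H}^d(y)+O(h^m)\quad (h\to0).$$ Then, if the bandwidths are chosen as $h_n=c\,n^{-1/(d+2m)}$ for a constant $c>0$, for $\mathcal{H}^d$-almost every $x\in\Omega$, $$\mathrm{MSE}(\hat p_n(x))=\mathbb{E}\big[(\hat p_n(x)-p(x))^2\big]=O\!\left(n^{-2m/(d+2m)}\right)\quad (n\to\infty).$$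
   Context: $\mathcal{H}^d$ denotes $d$-dimensional Hausdorff measure on $\mathbb{R}^D$. A set $\Omega\subset\mathbb{R}^D$ is $d$-rectifiable if $\Omega=\Omega_0\cup\bigcup_{j\in\mathbb{N}}F_j(A_j)$ with $\mathcal{H}^d(\Omega_0)=0$, $A_j\subset\mathbb{R}^d$, and each $F_j:\mathbb{R}^d\to\mathbb{R}^D$ Lipschitz. For a positive $\mathcal{H}^d$-measurable $\theta$ on $\Omega$ with $\int_{\Omega\cap C}\theta\,d\mathcal{H}^d<\infty$ for all compact $C$, a $d$-dimensional linear subspace $T_x\Omega\subset\mathbb{R}^D$ is an approximate tangent space to $\Omega$ at $x$ with respect to $\theta$ if $\lim_{h\to0}\int_{(\Omega-x)/h}f(y)\theta(x+hy)\,d\mathcal{H}^d(y)=\theta(x)\int_{T_x\Omega}f\,d\mathcal{H}^d$ for all continuous compactly supported $f$, where $(\Omega-x)/h=\{y\in\mathbb{R}^D: x+hy\in\Omega\}$. Given i.i.d. samples $X_1,\dots,X_n\sim P$, a kernel $K$ and bandwidth $h_n>0$, the estimator is $\hat p_n(x)=\frac{1}{n h_n^d}\sum_{i=1}^n K\!\left(\frac{\|X_i-x\|}{h_n}\right)$. *)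

theory Defs
  imports "HOL-Probability.Probability" "HOL-Library.Landau_Symbols"
begin

definition unit_ball_vol :: "nat \<Rightarrow> real" where
  "unit_ball_vol d = pi powr (real d / 2) / Gamma (real d / 2 + 1)"

definition hausdorff_pre :: "nat \<Rightarrow> real \<Rightarrow> 'a::metric_space set \<Rightarrow> ennreal" where
  "hausdorff_pre d \<delta> A = (INF C \<in> {C :: nat \<Rightarrow> 'a set. A \<subseteq> (\<Union>i. C i) \<and>
        (\<forall>i. bounded (C i) \<and> diameter (C i) \<le> \<delta>)}.
      (\<Sum>i. ennreal (if C i = {} then 0 else unit_ball_vol d * (diameter (C i) / 2) ^ d)))"

definition hausdorff_outer :: "nat \<Rightarrow> 'a::metric_space set \<Rightarrow> ennreal" where
  "hausdorff_outer d A = (SUP \<delta> \<in> {0<..}. hausdorff_pre d \<delta> A)"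

definition hausdorff_measure :: "nat \<Rightarrow> 'a::euclidean_space measure" where
  "hausdorff_measure d = completion (measure_of UNIV (sets borel) (hausdorff_outer d))"

definition rectifiable :: "'b::euclidean_space itself \<Rightarrow> 'a::euclidean_space set \<Rightarrow> bool" where
  "rectifiable _ \<Omega> \<longleftrightarrow> (\<exists>\<Omega>0 (A :: nat \<Rightarrow> 'b set) (F :: nat \<Rightarrow> 'b \<Rightarrow> 'a).
      hausdorff_outer DIM('b) \<Omega>0 = 0 \<and> (\<forall>j. \<exists>L. L-lipschitz_on UNIV (F j)) \<and>
      \<Omega> = \<Omega>0 \<union> (\<Union>j. F j ` A j))"

definition compactly_supported :: "('a::euclidean_space \<Rightarrow> real) \<Rightarrow> bool" where
  "compactly_supported f \<longleftrightarrow> compact (closure {y. f y \<noteq> 0})"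

definition approx_tangent_space ::
    "nat \<Rightarrow> 'a::euclidean_space set \<Rightarrow> ('a \<Rightarrow> real) \<Rightarrow> 'a \<Rightarrow> 'a set \<Rightarrow> bool" where
  "approx_tangent_space d \<Omega> \<theta> x T \<longleftrightarrow> subspace T \<and> dim T = d \<and>
     (\<forall>f. continuous_on UNIV f \<and> compactly_supported f \<longrightarrow>
        ((\<lambda>h. LINT y:{y. x + h *\<^sub>R y \<in> \<Omega>}|hausdorff_measure d. f y * \<theta> (x + h *\<^sub>R y))
          \<longlongrightarrow> \<theta> x * (LINT y:T|hausdorff_measure d. f y)) (at_right 0))"

definition kde :: "(real \<Rightarrow> real) \<Rightarrow> (nat \<Rightarrow> real) \<Rightarrow> nat \<Rightarrow> (nat \<Rightarrow> 'w \<Rightarrow> 'a::euclidean_space)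
    \<Rightarrow> nat \<Rightarrow> 'a \<Rightarrow> 'w \<Rightarrow> real" where
  "kde K h d X n x \<omega> = (1 / (real n * h n ^ d)) * (\<Sum>i<n. K (norm (X i \<omega> - x) / h n))"

end

theory Submission
  imports Defs
begin

text \<open>
  The mean squared error splits into variance and squared bias. Rescaling by the bandwidth turns the
  expectation of the estimator into the integral in (A.2) with \<open>f y = K (norm y)\<close>, and the variance is at
  most \<open>1 / (n h^d)\<close> times the same integral with \<open>K\<^sup>2\<close>, which is bounded as \<open>h\<close> tends to \<open>0\<close>. So the error is
  \<open>O(h^(2m)) + O(1 / (n h^d))\<close>, and the chosen bandwidth balances the two terms.

  The bias tends to \<open>0\<close> only because the limit \<open>p x * (LINT y:T. K (norm y))\<close> equals \<open>p x\<close>, which needs the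
  normalisation of Hausdorff measure: on a \<open>d\<close>-dimensional subspace it is exactly Lebesgue measure.
  One inequality is a Vitali covering by balls; the other is the isodiametric inequality, obtained from
  the Brunn-Minkowski inequality \<open>|A + B| \<ge> 2^d sqrt (|A| |B|)\<close> with \<open>B = - A\<close>, since \<open>A - A\<close> lies
  in the ball whose radius is the diameter of \<open>A\<close>.
\<close>

section \<open>Hausdorff outer measure\<close>

text \<open>The square root form of Brunn-Minkowski follows from the usual one by the
  arithmetic-geometric mean inequality. It is multiplicative over coordinates, hence elementary for
  boxes, and it loses nothing when both volumes agree, as they do for a set and its reflection. So
  it gives the sharp isodiametric constant without Steiner symmetrisation. Two obstacles shape the
  measure theory. For \<open>d\<close> below the dimension of the ambient space, Hausdorff measure
  is not sigma-finite, so measures cannot be identified by comparing them on a generator. The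
  scaling laws are therefore proved for the outer measure, through covers, and hold for arbitrary
  sets. Moreover \<open>p\<close> and \<open>\<Omega>\<close> are measurable only for the completed
  measure, so the change of variables has to be carried through the completion.\<close>

lemma unit_ball_vol_nonneg: "unit_ball_vol d \<ge> 0"
  unfolding unit_ball_vol_def by (auto intro!: divide_nonneg_nonneg Gamma_real_nonneg)

text \<open>One term of the sum in \<open>hausdorff_pre\<close>. The separate value at
  \<open>{}\<close> matters for \<open>d = 0\<close>: there \<open>0 ^ 0 = 1\<close> would charge
  for every empty set that pads a finite cover.\<close>

definition hausdorff_cost :: "nat \<Rightarrow> 'a::metric_space set \<Rightarrow> ennreal" where
  "hausdorff_cost d C = ennreal (if C = {} then 0 else unit_ball_vol d * (diameter C / 2) ^ d)"

lemma hausdorff_cost_empty [simp]: "hausdorff_cost d {} = 0"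
  by (simp add: hausdorff_cost_def)

lemma hausdorff_pre_le_suminf:
  assumes "A \<subseteq> (\<Union>i. C i)" "\<And>i. bounded (C i)" "\<And>i. diameter (C i) \<le> \<delta>"
  shows "hausdorff_pre d \<delta> A \<le> (\<Sum>i. hausdorff_cost d (C i))"
  unfolding hausdorff_pre_def hausdorff_cost_def
  by (rule INF_lower) (use assms in auto)

lemma hausdorff_pre_less_obtain:
  assumes "hausdorff_pre d \<delta> A < e"
  obtains C where "A \<subseteq> (\<Union>i. C i)" "\<And>i. bounded (C i)" "\<And>i. diameter (C i) \<le> \<delta>"
    "(\<Sum>i. hausdorff_cost d (C i)) < e"
  using assms unfolding hausdorff_pre_def INF_less_iff hausdorff_cost_def[symmetric] by auto

lemma le_hausdorff_pre:
  assumes "\<And>C. A \<subseteq> (\<Union>i. C i) \<Longrightarrow> (\<And>i. bounded (C i)) \<Longrightarrow> (\<And>i. diameter (C i) \<le> \<delta>)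
     \<Longrightarrow> m \<le> (\<Sum>i. hausdorff_cost d (C i))"
  shows "m \<le> hausdorff_pre d \<delta> A"
  unfolding hausdorff_pre_def hausdorff_cost_def[symmetric]
  by (rule INF_greatest) (use assms in auto)

lemma hausdorff_pre_mono: "A \<subseteq> B \<Longrightarrow> hausdorff_pre d \<delta> A \<le> hausdorff_pre d \<delta> B"
  by (rule le_hausdorff_pre, rule hausdorff_pre_le_suminf) auto

lemma hausdorff_pre_antimono:
  assumes "\<delta> \<le> \<epsilon>" shows "hausdorff_pre d \<epsilon> A \<le> hausdorff_pre d \<delta> A"
  by (rule le_hausdorff_pre, rule hausdorff_pre_le_suminf) (use assms order_trans in blast)+

lemma hausdorff_pre_le_cost:
  assumes "bounded S" "diameter S \<le> \<delta>" "0 \<le> \<delta>"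
  shows "hausdorff_pre d \<delta> S \<le> hausdorff_cost d S"
proof -
  have "hausdorff_pre d \<delta> S \<le> (\<Sum>i. hausdorff_cost d (if i = (0::nat) then S else {}))"
    by (rule hausdorff_pre_le_suminf) (use assms in \<open>auto split: if_splits\<close>)
  also have "\<dots> = hausdorff_cost d S"
    by (subst suminf_finite[of "{0}"]) auto
  finally show ?thesis .
qed

lemma hausdorff_pre_empty: "0 \<le> \<delta> \<Longrightarrow> hausdorff_pre d \<delta> {} = 0"
  using hausdorff_pre_le_cost[of "{}" \<delta> d] by simp

text \<open>Near-optimal covers of the \<open>A n\<close>, with slack \<open>e / 2^(n+1)\<close>,
  are merged into one sequence by \<open>prod_decode\<close>; the slacks add up to
  \<open>e\<close>.\<close>

lemma hausdorff_pre_countably_subadditive: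
  "hausdorff_pre d \<delta> (\<Union>i. A i) \<le> (\<Sum>i::nat. hausdorff_pre d \<delta> (A i))"
proof (rule ennreal_le_epsilon)
  fix e :: real assume "0 < e" and fin: "(\<Sum>i. hausdorff_pre d \<delta> (A i)) < top"
  then have *: "\<And>n. hausdorff_pre d \<delta> (A n) < hausdorff_pre d \<delta> (A n) + e * (1/2)^Suc n"
    by (auto simp add: less_top dest!: ennreal_suminf_lessD)
  obtain B where B: "\<And>n. A n \<subseteq> (\<Union>i. B n i)" "\<And>n i. bounded (B n i)"
      "\<And>n i. diameter (B n i) \<le> \<delta>"
      "\<And>n. (\<Sum>i. hausdorff_cost d (B n i)) < hausdorff_pre d \<delta> (A n) + e * (1/2)^Suc n"
    by (metis hausdorff_pre_less_obtain[OF *])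
  define C where "C = case_prod B o prod_decode"
  have A_C: "(\<Union>i. A i) \<subseteq> (\<Union>i. C i)"
  proof
    fix x assume "x \<in> (\<Union>i. A i)"
    then obtain n where "x \<in> A n" by auto
    then obtain i where "x \<in> B n i" using B(1) by blast
    then have "x \<in> C (prod_encode (n, i))" by (simp add: C_def)
    then show "x \<in> (\<Union>i. C i)" by blast
  qed
  have "hausdorff_pre d \<delta> (\<Union>i. A i) \<le> (\<Sum>i. hausdorff_cost d (C i))"
    by (rule hausdorff_pre_le_suminf[OF A_C]) (use B in \<open>auto simp: C_def split_def\<close>)
  also have "\<dots> = (\<Sum>n. \<Sum>i. hausdorff_cost d (B n i))"
    unfolding C_def comp_def
    using suminf_ennreal_2dimen[of "\<lambda>n. \<Sum>i. hausdorff_cost d (B n i)" "\<lambda>(n,i). hausdorff_cost d (B n i)"]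
    by (auto simp: split_def)
  also have "\<dots> \<le> (\<Sum>n. hausdorff_pre d \<delta> (A n) + e * (1/2) ^ Suc n)"
    by (intro suminf_le less_imp_le B summableI)
  also have "... = (\<Sum>n. hausdorff_pre d \<delta> (A n)) + (\<Sum>n. ennreal e * ennreal ((1/2) ^ Suc n))"
    using \<open>0 < e\<close> by (subst suminf_add[symmetric])
                     (auto simp del: ennreal_suminf_cmult simp add: ennreal_mult[symmetric])
  also have "\<dots> = (\<Sum>n. hausdorff_pre d \<delta> (A n)) + e"
    unfolding ennreal_suminf_cmult
    by (subst suminf_ennreal_eq[OF zero_le_power power_half_series]) auto
  finally show "hausdorff_pre d \<delta> (\<Union>i. A i) \<le> (\<Sum>n. hausdorff_pre d \<delta> (A n)) + e" .
qed

lemma hausdorff_pre_le_outer: "\<delta> > 0 \<Longrightarrow> hausdorff_pre d \<delta> A \<le> hausdorff_outer d A"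
  unfolding hausdorff_outer_def by (rule SUP_upper) auto

lemma hausdorff_outer_leI: "(\<And>\<delta>. \<delta> > 0 \<Longrightarrow> hausdorff_pre d \<delta> A \<le> m) \<Longrightarrow> hausdorff_outer d A \<le> m"
  unfolding hausdorff_outer_def by (rule SUP_least) auto

lemma hausdorff_outer_mono: "A \<subseteq> B \<Longrightarrow> hausdorff_outer d A \<le> hausdorff_outer d B"
  by (rule hausdorff_outer_leI) (meson hausdorff_pre_mono hausdorff_pre_le_outer order_trans)

lemma hausdorff_outer_empty [simp]: "hausdorff_outer d {} = 0"
  using hausdorff_outer_leI[of d "{}" 0] by (simp add: hausdorff_pre_empty)

lemma hausdorff_outer_countably_subadditive:
  "hausdorff_outer d (\<Union>i. A i) \<le> (\<Sum>i::nat. hausdorff_outer d (A i))"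
proof (rule hausdorff_outer_leI)
  fix \<delta> :: real assume "\<delta> > 0"
  then show "hausdorff_pre d \<delta> (\<Union>i. A i) \<le> (\<Sum>i. hausdorff_outer d (A i))"
    by (intro order_trans[OF hausdorff_pre_countably_subadditive] suminf_le hausdorff_pre_le_outer summableI)
qed

lemma outer_measure_space_hausdorff: "outer_measure_space (Pow UNIV) (hausdorff_outer d)"
  unfolding outer_measure_space_def positive_def increasing_def countably_subadditive_def
  by (auto intro: hausdorff_outer_mono hausdorff_outer_countably_subadditive)


lemma ennreal_SUP_add_le:
  fixes f g :: "_ \<Rightarrow> ennreal"
  assumes "I \<noteq> {}" "J \<noteq> {}" "\<And>i j. i \<in> I \<Longrightarrow> j \<in> J \<Longrightarrow> f i + g j \<le> c"
  shows "(SUP i\<in>I. f i) + (SUP j\<in>J. g j) \<le> c"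
proof -
  have "(SUP i\<in>I. f i) + g j \<le> c" if "j \<in> J" for j
    by (subst ennreal_SUP_add_left[OF assms(1), symmetric]) (auto intro!: SUP_least assms that)
  then show ?thesis
    by (subst add.commute, subst ennreal_SUP_add_left[OF assms(2), symmetric])
       (auto intro!: SUP_least simp: add.commute)
qed

text \<open>A set of diameter below \<open>r\<close> cannot meet both \<open>A\<close> and
  \<open>B\<close>, so a fine cover of the union falls apart into a cover of \<open>A\<close> and a
  cover of \<open>B\<close> that share no cost.\<close>

lemma hausdorff_outer_metric:
  assumes "r > 0" and far: "\<And>x y. x \<in> A \<Longrightarrow> y \<in> B \<Longrightarrow> r \<le> dist x y"
  shows "hausdorff_outer d A + hausdorff_outer d B \<le> hausdorff_outer d (A \<union> B)"
proof -
  have small: "hausdorff_pre d \<delta> A + hausdorff_pre d \<delta> B \<le> hausdorff_pre d \<delta> (A \<union> B)" if "\<delta> < r" "\<delta> > 0" for \<delta>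
  proof (rule le_hausdorff_pre)
    fix C :: "nat \<Rightarrow> _" assume C: "A \<union> B \<subseteq> (\<Union>i. C i)" "\<And>i. bounded (C i)" "\<And>i. diameter (C i) \<le> \<delta>"
    define CA where "CA = (\<lambda>i. if C i \<inter> A = {} then {} else C i)"
    define CB where "CB = (\<lambda>i. if C i \<inter> B = {} then {} else C i)"
    have disj: "C i \<inter> A = {} \<or> C i \<inter> B = {}" for i
    proof (rule ccontr)
      assume "\<not> ?thesis"
      then obtain x y where xy: "x \<in> C i" "x \<in> A" "y \<in> C i" "y \<in> B" by auto
      then have "dist x y \<le> diameter (C i)" using diameter_bounded_bound[OF C(2)] by auto
      with C(3)[of i] far[of x y] xy that show False by linarith
    qed
    have "hausdorff_pre d \<delta> A + hausdorff_pre d \<delta> B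
       \<le> (\<Sum>i. hausdorff_cost d (CA i)) + (\<Sum>i. hausdorff_cost d (CB i))"
      by (intro add_mono hausdorff_pre_le_suminf)
         (use C that in \<open>auto simp: CA_def CB_def; fastforce split: if_splits\<close>)+
    also have "\<dots> = (\<Sum>i. hausdorff_cost d (CA i) + hausdorff_cost d (CB i))"
      by (rule suminf_add) auto
    also have "\<dots> \<le> (\<Sum>i. hausdorff_cost d (C i))"
      using disj by (intro suminf_le summableI) (auto simp: CA_def CB_def)
    finally show "hausdorff_pre d \<delta> A + hausdorff_pre d \<delta> B \<le> (\<Sum>i. hausdorff_cost d (C i))" .
  qed
  \<comment> \<open>The two suprema run over independent scales. Passing to one common scale only
    raises both premeasures, and \<open>r/2\<close> keeps it strictly below
    \<open>r\<close>.\<close>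
  have *: "hausdorff_pre d \<delta> A + hausdorff_pre d \<epsilon> B \<le> hausdorff_outer d (A \<union> B)" if "\<delta> > 0" "\<epsilon> > 0" for \<delta> \<epsilon>
  proof -
    let ?m = "min (min \<delta> \<epsilon>) (r/2)"
    have "hausdorff_pre d \<delta> A + hausdorff_pre d \<epsilon> B \<le> hausdorff_pre d ?m A + hausdorff_pre d ?m B"
      by (intro add_mono hausdorff_pre_antimono) auto
    also have "\<dots> \<le> hausdorff_pre d ?m (A \<union> B)"
      using that \<open>r > 0\<close> by (intro small) auto
    also have "\<dots> \<le> hausdorff_outer d (A \<union> B)"
      using that \<open>r > 0\<close> by (intro hausdorff_pre_le_outer) auto
    finally show ?thesis .
  qed
  then show ?thesis
    unfolding hausdorff_outer_def[of d A] hausdorff_outer_def[of d B]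
    by (intro ennreal_SUP_add_le) auto
qed

section \<open>Caratheodory measurability of Borel sets\<close>

lemma hausdorff_outer_subadditive:
  "hausdorff_outer d (A \<union> B) \<le> hausdorff_outer d A + hausdorff_outer d B"
proof -
  have "hausdorff_outer d (\<Union>i. if i = 0 then A else if i = Suc 0 then B else {})
     \<le> (\<Sum>i. hausdorff_outer d (if i = 0 then A else if i = Suc 0 then B else {}))"
    by (rule hausdorff_outer_countably_subadditive)
  also have "\<dots> = hausdorff_outer d A + hausdorff_outer d B"
    by (subst suminf_finite[of "{0, Suc 0}"]) auto
  also have "(\<Union>i. if i = 0 then A else if i = Suc 0 then B else {}) = A \<union> B"
    by (auto split: if_splits)
  finally show ?thesis .
qed

text \<open>The gap \<open>r\<close> may depend on \<open>j\<close>, as it must for shells that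
  accumulate at a closed set: each induction step only separates the new set from the finitely many
  earlier ones.\<close>

lemma sum_separated_le_hausdorff_outer:
  fixes R :: "nat \<Rightarrow> 'a::metric_space set"
  assumes sub: "\<And>i. R i \<subseteq> S"
    and far: "\<And>j. \<exists>r>0. \<forall>i<j. \<forall>x\<in>R i. \<forall>y\<in>R j. r \<le> dist x y"
  shows "(\<Sum>i<n. hausdorff_outer d (R i)) \<le> hausdorff_outer d S"
proof -
  have "(\<Sum>i<n. hausdorff_outer d (R i)) \<le> hausdorff_outer d (\<Union>i<n. R i)" for n
  proof (induction n)
    case (Suc n)
    obtain r where r: "r > 0" "\<And>i x y. i < n \<Longrightarrow> x \<in> R i \<Longrightarrow> y \<in> R n \<Longrightarrow> r \<le> dist x y"
      using far[of n] by blast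
    have "(\<Sum>i<Suc n. hausdorff_outer d (R i)) \<le> hausdorff_outer d (\<Union>i<n. R i) + hausdorff_outer d (R n)"
      using Suc by (simp add: add_right_mono)
    also have "\<dots> \<le> hausdorff_outer d ((\<Union>i<n. R i) \<union> R n)"
      by (rule hausdorff_outer_metric[OF r(1)]) (use r(2) in auto)
    also have "(\<Union>i<n. R i) \<union> R n = (\<Union>i<Suc n. R i)"
      by (auto simp: less_Suc_eq)
    finally show ?case .
  qed simp
  also have "hausdorff_outer d (\<Union>i<n. R i) \<le> hausdorff_outer d S"
    by (rule hausdorff_outer_mono) (use sub in auto)
  finally show ?thesis .
qed

text \<open>
  Caratheodory's criterion for a metric outer measure: \<open>S - F\<close> is exhausted by the sets \<open>T k\<close> at
  positive distance from \<open>F\<close>, up to the shells \<open>R i\<close> with \<open>i \<ge> k\<close>. Shells whose indices have the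
  same parity are separated, so the measures of all shells have a finite sum, with vanishing tails.
\<close>

lemma hausdorff_outer_closed_split:
  fixes F :: "'a::metric_space set"
  assumes "closed F"
  shows "hausdorff_outer d (S \<inter> F) + hausdorff_outer d (S - F) \<le> hausdorff_outer d S"
proof (cases "hausdorff_outer d S = top \<or> F = {}")
  case True then show ?thesis by auto
next
  case False
  then have fin: "hausdorff_outer d S < top" and ne: "F \<noteq> {}" by (auto simp: top.not_eq_extremum)
  define g where "g = (\<lambda>x. infdist x F)"
  define a where "a = (\<lambda>k::nat. inverse (real (Suc k)))"
  define R where "R = (\<lambda>k. {x\<in>S. a (Suc k) \<le> g x \<and> g x \<le> a k})"
  define T where "T = (\<lambda>k. {x\<in>S. a k \<le> g x})"
  have lip: "g x \<le> g y + dist x y" for x y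
    unfolding g_def by (metis infdist_triangle)
  have a_mono: "a j \<le> a i" if "i \<le> j" for i j
    using that by (simp add: a_def le_imp_inverse_le)
  have a_strict: "a (Suc i) < a i" for i by (simp add: a_def)
  have apos: "a k > 0" for k by (simp add: a_def)
  have ato: "a \<longlonglongrightarrow> 0" unfolding a_def by (rule LIMSEQ_inverse_real_of_nat)
  have sep: "(\<Sum>i<n. hausdorff_outer d (R (2*i + e))) \<le> hausdorff_outer d S" for n e
  proof (rule sum_separated_le_hausdorff_outer)
    fix j
    show "\<exists>r>0. \<forall>i<j. \<forall>x\<in>R (2*i+e). \<forall>y\<in>R (2*j+e). r \<le> dist x y"
    proof (cases j)
      case (Suc l)
      show ?thesis
      proof (intro exI conjI allI impI ballI)
        \<comment> \<open>Since \<open>i \<le> l\<close>, points of the outer shell have distance at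
          least \<open>a (2*l+1+e)\<close> from \<open>F\<close>, while those of the inner one are
          within \<open>a (2*j+e)\<close>. As \<open>2*j = 2*l+2\<close>, a whole shell lies between
          them, and its width is the gap.\<close>
        show "a (2*l+1+e) - a (2*j+e) > 0" using a_strict[of "2*l+1+e"] Suc by simp
        fix i x y assume "i < j" "x \<in> R (2*i+e)" "y \<in> R (2*j+e)"
        then have "a (2*i+1+e) \<le> g x" "g y \<le> a (2*j+e)" by (auto simp: R_def)
        moreover have "a (2*l+1+e) \<le> a (2*i+1+e)" using \<open>i < j\<close> Suc by (intro a_mono) auto
        ultimately show "a (2*l+1+e) - a (2*j+e) \<le> dist x y" using lip[of x y] by linarith
      qed
    qed (auto intro: exI[of _ 1])
  qed (auto simp: R_def)
  have "(\<Sum>i<n. hausdorff_outer d (R i)) \<le> hausdorff_outer d S + hausdorff_outer d S" for n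
  proof -
    have "(\<Sum>i<n. hausdorff_outer d (R i)) \<le> (\<Sum>i<2*n. hausdorff_outer d (R i))"
      by (rule sum_mono2) auto
    also have "\<dots> = (\<Sum>i<n. hausdorff_outer d (R (2*i+0))) + (\<Sum>i<n. hausdorff_outer d (R (2*i+1)))"
      by (induction n) (auto simp: algebra_simps)
    also have "\<dots> \<le> hausdorff_outer d S + hausdorff_outer d S" by (intro add_mono sep)
    finally show ?thesis .
  qed
  then have "(\<Sum>i. hausdorff_outer d (R i)) \<le> hausdorff_outer d S + hausdorff_outer d S"
    by (intro suminf_le_const) auto
  also have "\<dots> < top" using fin by simp
  finally have sumfin: "(\<Sum>i. hausdorff_outer d (R i)) \<noteq> top" by simp
  \<comment> \<open>Subtraction in \<open>ennreal\<close> behaves well only at finite values, so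
    \<open>sumfin\<close> has to come first.\<close>
  have tail: "(\<lambda>k. \<Sum>i. hausdorff_outer d (R (i + k))) \<longlonglongrightarrow> 0"
  proof -
    have "(\<lambda>k. (\<Sum>i. hausdorff_outer d (R i)) - (\<Sum>i<k. hausdorff_outer d (R i)))
       \<longlonglongrightarrow> (\<Sum>i. hausdorff_outer d (R i)) - (\<Sum>i. hausdorff_outer d (R i))"
      by (intro tendsto_diff_ennreal tendsto_const summable_LIMSEQ summableI sumfin)
    moreover have "(\<Sum>i. hausdorff_outer d (R i)) - (\<Sum>i<k. hausdorff_outer d (R i))
       = (\<Sum>i. hausdorff_outer d (R (i + k)))" for k
    proof -
      have eq: "(\<Sum>i. hausdorff_outer d (R i))
         = (\<Sum>i. hausdorff_outer d (R (i + k))) + (\<Sum>i<k. hausdorff_outer d (R i))"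
        by (rule suminf_offset) (rule summableI)
      moreover have "(\<Sum>i<k. hausdorff_outer d (R i)) \<noteq> top"
        using sumfin unfolding eq by (simp add: ennreal_add_eq_top)
      ultimately show ?thesis by (simp add: ennreal_add_diff_cancel_right)
    qed
    ultimately show ?thesis using sumfin by simp
  qed
  have T: "hausdorff_outer d (S \<inter> F) + hausdorff_outer d (T k) \<le> hausdorff_outer d S" for k
  proof -
    have "a k \<le> dist x y" if "x \<in> S \<inter> F" "y \<in> T k" for x y
      using that infdist_le[of x F y] by (auto simp: T_def g_def dist_commute)
    then have "hausdorff_outer d (S \<inter> F) + hausdorff_outer d (T k) \<le> hausdorff_outer d (S \<inter> F \<union> T k)"
      by (rule hausdorff_outer_metric[OF apos[of k]])
    also have "\<dots> \<le> hausdorff_outer d S" by (rule hausdorff_outer_mono) (auto simp: T_def)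
    finally show ?thesis .
  qed
  have main: "hausdorff_outer d (S \<inter> F) + hausdorff_outer d (S - F)
     \<le> hausdorff_outer d S + (\<Sum>i. hausdorff_outer d (R (i + k)))" for k
  proof -
    have "S - F \<subseteq> T k \<union> (\<Union>i. R (i + k))"
    proof
      fix x assume x: "x \<in> S - F"
      then have "g x > 0" unfolding g_def using assms ne
        by (metis DiffD2 in_closed_iff_infdist_zero infdist_nonneg less_eq_real_def)
      show "x \<in> T k \<union> (\<Union>i. R (i + k))"
      proof (cases "a k \<le> g x")
        case False
        from order_tendstoD(2)[OF ato \<open>g x > 0\<close>] obtain n where n: "a n < g x"
          by (auto simp: eventually_sequentially)
        \<comment> \<open>The first threshold not above \<open>g x\<close>; its predecessor still
          exceeds \<open>g x\<close>, which places \<open>x\<close> in the shell \<open>R l\<close>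
          with \<open>j = Suc l\<close>.\<close>
        define j where "j = (LEAST j. a j \<le> g x)"
        have j: "a j \<le> g x" unfolding j_def by (rule LeastI[of _ n]) (use n in auto)
        have "j > k" using False j a_mono[of j k] by (meson linorder_not_less order_trans)
        then obtain l where l: "j = Suc l" "l \<ge> k" by (metis less_Suc_eq_le lessE order_le_less)
        have "\<not> a l \<le> g x" using not_less_Least[of l "\<lambda>j. a j \<le> g x"] l by (auto simp: j_def[symmetric])
        then have "x \<in> R l" using x j l by (auto simp: R_def)
        then have "x \<in> R ((l - k) + k)" using l by simp
        then show ?thesis by blast
      qed (use x in \<open>auto simp: T_def\<close>)
    qed
    then have "hausdorff_outer d (S - F) \<le> hausdorff_outer d (T k \<union> (\<Union>i. R (i + k)))"
      by (rule hausdorff_outer_mono)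
    also have "\<dots> \<le> hausdorff_outer d (T k) + hausdorff_outer d (\<Union>i. R (i + k))"
      by (rule hausdorff_outer_subadditive)
    also have "\<dots> \<le> hausdorff_outer d (T k) + (\<Sum>i. hausdorff_outer d (R (i + k)))"
      by (intro add_left_mono hausdorff_outer_countably_subadditive)
    finally have "hausdorff_outer d (S \<inter> F) + hausdorff_outer d (S - F)
      \<le> hausdorff_outer d (S \<inter> F) + hausdorff_outer d (T k) + (\<Sum>i. hausdorff_outer d (R (i + k)))"
      by (simp add: add.assoc add_left_mono)
    also have "\<dots> \<le> hausdorff_outer d S + (\<Sum>i. hausdorff_outer d (R (i + k)))"
      by (intro add_right_mono T)
    finally show ?thesis .
  qed
  have "(\<lambda>k. hausdorff_outer d S + (\<Sum>i. hausdorff_outer d (R (i + k)))) \<longlonglongrightarrow> hausdorff_outer d S + 0"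
    by (intro tendsto_add tendsto_const tail)
  from LIMSEQ_le_const[OF this] main show ?thesis by auto
qed

text \<open>\<open>measure_of\<close> yields the zero measure unless it is given a measure space, so
  this is what ties \<open>hausdorff_measure\<close> to the outer measure. The Caratheodory sets
  form a sigma-algebra that contains the closed sets, hence all Borel sets.\<close>

lemma measure_space_hausdorff:
  "measure_space UNIV (sets (borel :: 'a::metric_space measure)) (hausdorff_outer d)"
proof -
  let ?L = "lambda_system UNIV (Pow UNIV) (hausdorff_outer d :: 'a set \<Rightarrow> ennreal)"
  have ms: "measure_space UNIV ?L (hausdorff_outer d)"
    by (rule sigma_algebra.caratheodory_lemma[OF sigma_algebra_Pow outer_measure_space_hausdorff])
  have "F \<in> ?L" if "closed F" for F
  proof -
    have "hausdorff_outer d (F \<inter> x) + hausdorff_outer d ((UNIV - F) \<inter> x) = hausdorff_outer d x" for x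
    proof (rule antisym)
      show "hausdorff_outer d (F \<inter> x) + hausdorff_outer d ((UNIV - F) \<inter> x) \<le> hausdorff_outer d x"
        using hausdorff_outer_closed_split[OF that, of d x]
        by (simp add: Int_commute Diff_eq)
      show "hausdorff_outer d x \<le> hausdorff_outer d (F \<inter> x) + hausdorff_outer d ((UNIV - F) \<inter> x)"
        by (rule order_trans[OF hausdorff_outer_mono hausdorff_outer_subadditive]) auto
    qed
    then show ?thesis by (auto simp: lambda_system_def)
  qed
  then have "sigma_sets UNIV (Collect closed) \<subseteq> ?L"
    using ms by (intro sigma_algebra.sigma_sets_subset) (auto simp: measure_space_def)
  then have sub: "sets (borel :: 'a measure) \<subseteq> ?L"
    by (simp add: borel_eq_closed sets_measure_of)
  have "countably_additive (sets (borel :: 'a measure)) (hausdorff_outer d)"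
  proof (rule countably_additiveI)
    fix A :: "nat \<Rightarrow> 'a set"
    assume A: "range A \<subseteq> sets borel" "disjoint_family A" "(\<Union>i. A i) \<in> sets borel"
    have "countably_additive ?L (hausdorff_outer d)" using ms by (simp add: measure_space_def)
    moreover have "range A \<subseteq> ?L" "(\<Union>i. A i) \<in> ?L" using A sub by blast+
    ultimately show "(\<Sum>i. hausdorff_outer d (A i)) = hausdorff_outer d (\<Union>i. A i)"
      using A(2) unfolding countably_additive_def by blast
  qed
  moreover have "sigma_algebra UNIV (sets (borel :: 'a measure))"
    by (metis sets.sigma_algebra_axioms space_borel)
  ultimately show ?thesis
    by (simp add: measure_space_def positive_def)
qed

lemma emeasure_measure_of_hausdorff_outer:
  assumes "A \<in> sets borel"
  shows "emeasure (measure_of UNIV (sets borel) (hausdorff_outer d)) A = hausdorff_outer d A"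
proof (rule emeasure_measure_of_sigma)
  show "sigma_algebra UNIV (sets (borel :: 'a measure))"
    by (metis sets.sigma_algebra_axioms space_borel)
qed (use measure_space_hausdorff[of d, where 'a='a] assms in \<open>simp_all add: measure_space_def\<close>)

section \<open>The Brunn-Minkowski inequality\<close>

lemma hyperplane_null_sets_lborel:
  fixes b :: "'a::euclidean_space"
  assumes "b \<in> Basis" shows "{x. x \<bullet> b = t} \<in> null_sets lborel"
proof -
  have "{x. x \<bullet> b = t} \<in> null_sets lebesgue"
    using negligible_standard_hyperplane[OF assms, of t]
    by (simp add: negligible_iff_null_sets inner_commute)
  moreover have "{x. x \<bullet> b = t} \<in> sets borel" by measurable
  ultimately show ?thesis by (simp add: null_sets_completion_iff)
qed

lemma measure_lborel_hyperplane_cut: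
  fixes b :: "'a::euclidean_space"
  assumes "b \<in> Basis" "V \<in> sets borel" "emeasure lborel V < \<infinity>"
  shows "measure lborel V = measure lborel (V \<inter> {x. x \<bullet> b < t}) + measure lborel (V \<inter> {x. t < x \<bullet> b})"
proof -
  have "measure lborel V = measure lborel (V - {x. x \<bullet> b = t})"
    using assms by (intro measure_Diff_null_set[symmetric] hyperplane_null_sets_lborel) auto
  moreover have "V - {x. x \<bullet> b = t} = (V \<inter> {x. x \<bullet> b < t}) \<union> (V \<inter> {x. t < x \<bullet> b})" by auto
  moreover have "measure lborel ((V \<inter> {x. x \<bullet> b < t}) \<union> (V \<inter> {x. t < x \<bullet> b}))
      = measure lborel (V \<inter> {x. x \<bullet> b < t}) + measure lborel (V \<inter> {x. t < x \<bullet> b})"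
    using assms
    by (intro measure_Union order.strict_implies_not_eq[OF order.strict_trans1[OF emeasure_mono assms(3)]]) auto
  ultimately show ?thesis by simp
qed

text \<open>The volume of the part of \<open>V\<close> up to height \<open>t\<close> is the
  distribution function of \<open>V\<close> projected to the axis \<open>b\<close>. Hyperplanes are
  null, so this function is continuous and the intermediate value theorem applies.\<close>

lemma lborel_hyperplane_cut_exists:
  fixes b :: "'a::euclidean_space"
  assumes b: "b \<in> Basis" and V: "V \<in> sets borel" "emeasure lborel V < \<infinity>" and c: "0 < c" "c < measure lborel V"
  obtains t where "measure lborel (V \<inter> {x. x \<bullet> b < t}) = c"
proof -
  define M where "M = distr (density lborel (indicator V)) borel (\<lambda>x. x \<bullet> b)"
  have em: "emeasure M A = emeasure lborel (V \<inter> {x. x \<bullet> b \<in> A})" if [measurable]: "A \<in> sets borel" for A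
  proof -
    have "emeasure M A = emeasure (density lborel (indicator V)) {x. x \<bullet> b \<in> A}"
      unfolding M_def by (subst emeasure_distr) (auto simp: vimage_def)
    also have "\<dots> = emeasure lborel (V \<inter> {x. x \<bullet> b \<in> A})"
      using V(1) by (subst emeasure_density) (auto simp: indicator_inter_arith[symmetric] intro: borel_measurable_indicator)
    finally show ?thesis .
  qed
  have "emeasure M (space M) \<noteq> \<infinity>"
    using em[of UNIV] V by (auto simp: M_def)
  then interpret finite_borel_measure M
    by (intro finite_borel_measure.intro finite_measureI finite_borel_measure_axioms.intro)
       (simp_all add: M_def)
  have "emeasure M {x} = 0" for x
  proof -
    have "emeasure lborel (V \<inter> {y. y \<bullet> b \<in> {x}}) \<le> emeasure lborel {y. y \<bullet> b = x}"
      using V by (intro emeasure_mono) auto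
    then show ?thesis
      using em[of "{x}"] null_setsD1[OF hyperplane_null_sets_lborel[OF b, of x]] by simp
  qed
  then have cont: "isCont (cdf M) x" for x
    by (simp add: isCont_cdf measure_def)
  have top: "measure M (space M) = measure lborel V"
    using em[of UNIV] by (simp add: measure_def M_def)
  obtain l where l: "cdf M l < c"
    using order_tendstoD(2)[OF cdf_lim_at_bot c(1)] by (meson eventually_at_bot_linorder order_refl)
  obtain u where u: "c < cdf M u"
    using order_tendstoD(1)[OF cdf_lim_at_top] c(2) unfolding top by (meson eventually_at_top_linorder order_refl)
  have "l \<le> u" using l u cdf_nondecreasing by (meson linorder_le_cases not_less order_trans less_imp_le)
  then obtain t where t: "cdf M t = c"
    using IVT[of "cdf M" l c u] l u cont by auto
  have "measure lborel (V \<inter> {x. x \<bullet> b \<le> t}) = c"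
    using t em[of "{..t}"] by (simp add: cdf_def measure_def)
  moreover have "measure lborel (V \<inter> {x. x \<bullet> b < t}) = measure lborel (V \<inter> {x. x \<bullet> b \<le> t} - {x. x \<bullet> b = t})"
    by (rule arg_cong[of _ _ "measure lborel"]) auto
  moreover have "\<dots> = measure lborel (V \<inter> {x. x \<bullet> b \<le> t})"
    using V by (intro measure_Diff_null_set hyperplane_null_sets_lborel b) auto
  ultimately show ?thesis using that by simp
qed

section \<open>Minkowski sums of finite unions of boxes\<close>

definition sumset :: "'a::plus set \<Rightarrow> 'a set \<Rightarrow> 'a set" where
  "sumset A B = {x + y | x y. x \<in> A \<and> y \<in> B}"

lemma sumset_commute: "sumset A B = sumset B (A :: 'a::ab_semigroup_add set)"
  by (auto simp: sumset_def) (metis add.commute)+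

lemma open_sumset:
  fixes A B :: "'a::real_normed_vector set"
  assumes "open A" shows "open (sumset A B)"
proof -
  have "sumset A B = (\<Union>y\<in>B. (+) y ` A)" by (auto simp: sumset_def image_iff) (metis add.commute)+
  then show ?thesis using open_translation[OF assms] by auto
qed

lemma bounded_sumset:
  fixes A B :: "'a::real_normed_vector set"
  assumes "bounded A" "bounded B" shows "bounded (sumset A B)"
  using bounded_plus[OF assms] by (rule bounded_subset) (auto simp: sumset_def)

text \<open>Open boxes remain open boxes when cut by an open half-space, and only a null set is lost
  on the hyperplane. Excluding the empty box makes \<open>card\<close> a suitable induction measure:
  a box missed by the half-space leaves the family.\<close>

definition disjoint_boxes :: "'a::euclidean_space set set \<Rightarrow> bool" where
  "disjoint_boxes \<A> \<longleftrightarrow> finite \<A> \<and> disjoint \<A> \<and> (\<forall>B\<in>\<A>. B \<noteq> {} \<and> (\<exists>l u. B = box l u))"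

definition cut_boxes :: "'a set set \<Rightarrow> 'a set \<Rightarrow> 'a set set" where
  "cut_boxes \<A> H = (\<lambda>B. B \<inter> H) ` \<A> - {{}}"

lemma Union_cut_boxes: "\<Union>(cut_boxes \<A> H) = \<Union>\<A> \<inter> H"
  by (auto simp: cut_boxes_def)

lemma card_cut_boxes: "finite \<A> \<Longrightarrow> card (cut_boxes \<A> H) \<le> card \<A>"
  unfolding cut_boxes_def by (meson card_Diff1_le card_image_le finite_imageI le_trans)

lemma card_cut_boxes_less:
  assumes "finite \<A>" "B \<in> \<A>" "B \<inter> H = {}"
  shows "card (cut_boxes \<A> H) < card \<A>"
proof -
  have "cut_boxes \<A> H \<subseteq> (\<lambda>B. B \<inter> H) ` (\<A> - {B})" using assms by (auto simp: cut_boxes_def)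
  then have "card (cut_boxes \<A> H) \<le> card (\<A> - {B})"
    using assms by (meson card_image_le card_mono finite_Diff finite_imageI le_trans)
  also have "\<dots> < card \<A>" using assms by (intro card_Diff1_less)
  finally show ?thesis .
qed

lemma box_Int_greaterThan:
  assumes "b \<in> Basis" shows "\<exists>l' u'. box l u \<inter> {x. t < x \<bullet> b} = box l' u'"
proof -
  have "box l u \<inter> {x. t < x \<bullet> b} = box (l + (max (l \<bullet> b) t - l \<bullet> b) *\<^sub>R b) u"
  proof (intro set_eqI)
    fix x
    have "(l + (max (l \<bullet> b) t - l \<bullet> b) *\<^sub>R b) \<bullet> i = (if i = b then max (l \<bullet> b) t else l \<bullet> i)" if "i \<in> Basis" for i
      using assms that by (simp add: inner_add_left inner_Basis)
    then show "x \<in> box l u \<inter> {x. t < x \<bullet> b} \<longleftrightarrow> x \<in> box (l + (max (l \<bullet> b) t - l \<bullet> b) *\<^sub>R b) u"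
      using assms by (auto simp: mem_box)
  qed
  then show ?thesis by blast
qed

lemma box_Int_lessThan:
  assumes "b \<in> Basis" shows "\<exists>l' u'. box l u \<inter> {x. x \<bullet> b < t} = box l' u'"
proof -
  have "box l u \<inter> {x. x \<bullet> b < t} = box l (u + (min (u \<bullet> b) t - u \<bullet> b) *\<^sub>R b)"
  proof (intro set_eqI)
    fix x
    have "(u + (min (u \<bullet> b) t - u \<bullet> b) *\<^sub>R b) \<bullet> i = (if i = b then min (u \<bullet> b) t else u \<bullet> i)" if "i \<in> Basis" for i
      using assms that by (simp add: inner_add_left inner_Basis)
    then show "x \<in> box l u \<inter> {x. x \<bullet> b < t} \<longleftrightarrow> x \<in> box l (u + (min (u \<bullet> b) t - u \<bullet> b) *\<^sub>R b)"
      using assms by (auto simp: mem_box)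
  qed
  then show ?thesis by blast
qed

lemma disjoint_boxes_cut:
  assumes "disjoint_boxes \<A>" "\<And>l u. \<exists>l' u'. box l u \<inter> H = box l' u'"
  shows "disjoint_boxes (cut_boxes \<A> H)"
  unfolding disjoint_boxes_def cut_boxes_def
proof (intro conjI ballI)
  show "disjoint ((\<lambda>B. B \<inter> H) ` \<A> - {{}})"
    using assms(1) unfolding disjoint_boxes_def disjoint_def by blast
qed (use assms in \<open>auto simp: disjoint_boxes_def\<close>)

lemma disjoint_boxes_open: "disjoint_boxes \<A> \<Longrightarrow> open (\<Union>\<A>)"
  unfolding disjoint_boxes_def by (metis open_Union open_box)

lemma disjoint_boxes_bounded: "disjoint_boxes \<A> \<Longrightarrow> bounded (\<Union>\<A>)"
  unfolding disjoint_boxes_def by (metis bounded_Union bounded_box)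

lemma disjoint_boxes_borel: "disjoint_boxes \<A> \<Longrightarrow> \<Union>\<A> \<in> sets borel"
  by (simp add: disjoint_boxes_open)

lemma disjoint_boxes_finite: "disjoint_boxes \<A> \<Longrightarrow> emeasure lborel (\<Union>\<A>) < \<infinity>"
  by (intro emeasure_bounded_finite disjoint_boxes_bounded)

lemma open_bounded_fmeasurable:
  fixes V :: "'a::euclidean_space set"
  assumes "open V" "bounded V" shows "V \<in> fmeasurable lborel"
  using assms emeasure_bounded_finite[OF assms(2)] by (intro fmeasurableI) auto

lemma measure_open_pos:
  fixes V :: "'a::euclidean_space set"
  assumes "open V" "bounded V" "V \<noteq> {}" shows "0 < measure lborel V"
proof -
  obtain x e where "x \<in> V" "e > 0" "ball x e \<subseteq> V" using assms by (meson ex_in_conv openE)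
  have "0 < measure lborel (ball x e)" using content_ball_pos[OF \<open>e > 0\<close>] by simp
  also have "\<dots> \<le> measure lborel V"
    using \<open>ball x e \<subseteq> V\<close> assms by (intro measure_mono_fmeasurable open_bounded_fmeasurable) auto
  finally show ?thesis .
qed

lemma sqrt_prod: "sqrt (prod f A) = (\<Prod>x\<in>A. sqrt (f x))"
  by (induction A rule: infinite_finite_induct) (auto simp: real_sqrt_mult)

text \<open>The sum of two boxes contains the box whose sides are the sums of their sides. The
  inequality \<open>2 * sqrt (x * y) \<le> x + y\<close> for each side multiplies up to the factor
  \<open>2 ^ DIM('a)\<close>.\<close>

lemma sumset_box_measure:
  fixes l u l' u' :: "'a::euclidean_space"
  assumes "box l u \<noteq> {}" "box l' u' \<noteq> {}"
  shows "2 ^ DIM('a) * sqrt (measure lborel (box l u) * measure lborel (box l' u'))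
     \<le> measure lborel (sumset (box l u) (box l' u'))"
proof -
  have lt: "\<And>i. i \<in> Basis \<Longrightarrow> l \<bullet> i < u \<bullet> i" "\<And>i. i \<in> Basis \<Longrightarrow> l' \<bullet> i < u' \<bullet> i"
    using assms by (auto simp: box_ne_empty)
  have sub: "box (l + l') (u + u') \<subseteq> sumset (box l u) (box l' u')"
  proof
    fix z assume z: "z \<in> box (l + l') (u + u')"
    \<comment> \<open>The relative position of \<open>z\<close> in the large box; points at this
      same relative position in the two small boxes add up to \<open>z\<close>.\<close>
    define \<theta> where "\<theta> = (\<lambda>i. ((z - l - l') \<bullet> i) / ((u - l) \<bullet> i + (u' - l') \<bullet> i))"
    define x where "x = (\<Sum>i\<in>Basis. (l \<bullet> i + \<theta> i * ((u - l) \<bullet> i)) *\<^sub>R i)"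
    have xi: "x \<bullet> i = l \<bullet> i + \<theta> i * ((u - l) \<bullet> i)" if "i \<in> Basis" for i
      using that by (simp add: x_def)
    have th: "0 < \<theta> i" "\<theta> i < 1" "\<theta> i * ((u - l) \<bullet> i + (u' - l') \<bullet> i) = (z - l - l') \<bullet> i" if "i \<in> Basis" for i
      using lt[OF that] z that unfolding \<theta>_def
      by (auto simp: mem_box inner_diff_left inner_add_left divide_simps algebra_simps)
    have scale: "t * (b - a) < b - a" if "t < 1" "a < b" for t a b :: real
      using mult_strict_right_mono[of t 1 "b - a"] that by simp
    have "x \<in> box l u"
      unfolding mem_box
    proof (intro ballI conjI)
      fix i :: 'a assume i: "i \<in> Basis"
      show "l \<bullet> i < x \<bullet> i" using th(1)[OF i] lt(1)[OF i] by (simp add: xi[OF i] inner_diff_left)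
      show "x \<bullet> i < u \<bullet> i"
        using scale[OF th(2)[OF i] lt(1)[OF i]] by (simp add: xi[OF i] inner_diff_left)
    qed
    moreover have "z - x \<in> box l' u'"
    proof -
      have "(z - x) \<bullet> i = l' \<bullet> i + \<theta> i * ((u' - l') \<bullet> i)" if "i \<in> Basis" for i
        using th(3)[OF that] by (simp add: inner_diff_left xi[OF that] algebra_simps)
      note zx = this
      show ?thesis
        unfolding mem_box
      proof (intro ballI conjI)
        fix i :: 'a assume i: "i \<in> Basis"
        show "l' \<bullet> i < (z - x) \<bullet> i"
          unfolding zx[OF i] using th(1)[OF i] lt(2)[OF i] by (simp add: inner_diff_left)
        show "(z - x) \<bullet> i < u' \<bullet> i"
          unfolding zx[OF i] using scale[OF th(2)[OF i] lt(2)[OF i]] by (simp add: inner_diff_left)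
      qed
    qed
    ultimately show "z \<in> sumset (box l u) (box l' u')" by (force simp: sumset_def)
  qed
  have amgm: "2 * sqrt (x * y) \<le> x + y" if "x > 0" "y > 0" for x y :: real
    using arith_geo_mean_sqrt[of x y] that by simp
  have "2 ^ DIM('a) * sqrt (measure lborel (box l u) * measure lborel (box l' u'))
    = (\<Prod>i\<in>(Basis::'a set). 2 * sqrt (((u - l) \<bullet> i) * ((u' - l') \<bullet> i)))"
    using lt by (simp add: measure_lborel_box_eq less_imp_le prod.distrib sqrt_prod real_sqrt_mult)
  also have "\<dots> \<le> (\<Prod>i\<in>Basis. (u - l) \<bullet> i + (u' - l') \<bullet> i)"
    using lt by (intro prod_mono conjI amgm) (auto simp: inner_diff_left less_imp_le)
  also have "\<dots> = measure lborel (box (l + l') (u + u'))"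
    using lt by (subst measure_lborel_box_eq) (auto simp: inner_diff_left inner_add_left less_imp_le add_mono intro!: prod.cong)
  also have "\<dots> \<le> measure lborel (sumset (box l u) (box l' u'))"
    by (intro measure_mono_fmeasurable sub open_bounded_fmeasurable bounded_sumset open_sumset) auto
  finally show ?thesis .
qed

text \<open>Disjoint nonempty boxes have disjoint projections to some axis, so a face of one of them
  spans a separating hyperplane. Each open half-space then misses one of the two boxes, which makes
  both halves of the family smaller.\<close>

lemma disjoint_boxes_separated:
  assumes "disjoint_boxes \<A>" "card \<A> \<ge> 2"
  obtains b t B C where "b \<in> Basis" "B \<in> \<A>" "C \<in> \<A>" "B \<inter> {x. x \<bullet> b < t} = {}" "C \<inter> {x. t < x \<bullet> b} = {}"
proof -
  obtain B C where BC: "B \<in> \<A>" "C \<in> \<A>" "B \<noteq> C"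
    using assms(2) by (metis card_le_Suc0_iff_eq card_eq_0_iff not_less_eq_eq numeral_2_eq_2 zero_le)
  obtain l u l' u' where B: "B = box l u" and C: "C = box l' u'" and ne: "B \<noteq> {}" "C \<noteq> {}"
    using assms(1) BC unfolding disjoint_boxes_def by meson
  have "B \<inter> C = {}" using assms(1) BC by (auto simp: disjoint_boxes_def disjoint_def)
  then obtain i where i: "i \<in> Basis" "u \<bullet> i \<le> l \<bullet> i \<or> u' \<bullet> i \<le> l' \<bullet> i \<or> u \<bullet> i \<le> l' \<bullet> i \<or> u' \<bullet> i \<le> l \<bullet> i"
    unfolding B C disjoint_interval by blast
  then have "u \<bullet> i \<le> l' \<bullet> i \<or> u' \<bullet> i \<le> l \<bullet> i"
    using ne unfolding B C box_ne_empty by force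
  then show ?thesis
  proof
    assume "u \<bullet> i \<le> l' \<bullet> i"
    then show ?thesis
      by (intro that[of i C B "l' \<bullet> i"]) (use BC i in \<open>force simp: B C mem_box\<close>)+
  next
    assume "u' \<bullet> i \<le> l \<bullet> i"
    then show ?thesis
      by (intro that[of i B C "l \<bullet> i"]) (use BC i in \<open>force simp: B C mem_box\<close>)+
  qed
qed

text \<open>
  Hadwiger-Ohmann induction on the number of boxes: a coordinate hyperplane separating two boxes of
  \<open>\<A>\<close> cuts \<open>\<A>\<close>, a parallel one cuts \<open>\<B>\<close> in the same ratio of volumes, and the sums of
  corresponding halves are disjoint.
\<close>

lemma sumset_disjoint_boxes_measure:
  fixes \<A> \<B> :: "'a::euclidean_space set set"
  assumes "disjoint_boxes \<A>" "disjoint_boxes \<B>" "\<A> \<noteq> {}" "\<B> \<noteq> {}"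
  shows "2 ^ DIM('a) * sqrt (measure lborel (\<Union>\<A>) * measure lborel (\<Union>\<B>))
     \<le> measure lborel (sumset (\<Union>\<A>) (\<Union>\<B>))"
  using assms
proof (induction "card \<A> + card \<B>" arbitrary: \<A> \<B> rule: less_induct)
  case less
  define P :: "'a set set \<Rightarrow> 'a set set \<Rightarrow> bool" where
    "P = (\<lambda>\<A> \<B>. 2 ^ DIM('a) * sqrt (measure lborel (\<Union>\<A>) * measure lborel (\<Union>\<B>))
     \<le> measure lborel (sumset (\<Union>\<A>) (\<Union>\<B>)))"
  \<comment> \<open>Stated for arbitrary families with their own induction hypothesis, so that it
    also applies with the families exchanged when it is the second one that has two boxes.\<close>
  have step: "P \<A> \<B>"
    if dA: "disjoint_boxes \<A>" and dB: "disjoint_boxes \<B>" and ne: "\<A> \<noteq> {}" "\<B> \<noteq> {}"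
      and IH: "\<And>\<A>' \<B>'. \<lbrakk>card \<A>' + card \<B>' < card \<A> + card \<B>; disjoint_boxes \<A>'; disjoint_boxes \<B>';
        \<A>' \<noteq> {}; \<B>' \<noteq> {}\<rbrakk> \<Longrightarrow> P \<A>' \<B>'" and two: "card \<A> \<ge> 2" for \<A> \<B>
  proof -
    have pos: "0 < measure lborel (\<Union>\<A>)" if "disjoint_boxes \<A>" "\<A> \<noteq> {}" for \<A> :: "'a set set"
      using that by (intro measure_open_pos disjoint_boxes_open disjoint_boxes_bounded)
        (auto simp: disjoint_boxes_def)
    obtain b t Q R where b: "b \<in> Basis" and Q: "Q \<in> \<A>" "Q \<inter> {x. x \<bullet> b < t} = {}"
        and R: "R \<in> \<A>" "R \<inter> {x. t < x \<bullet> b} = {}"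
      using disjoint_boxes_separated[OF dA two] by metis
    have neQR: "Q \<noteq> {}" "R \<noteq> {}" and oQR: "open Q" "open R"
      using dA Q R by (auto simp: disjoint_boxes_def)
    define lo hi where "lo = (\<lambda>s. {x::'a. x \<bullet> b < s})" and "hi = (\<lambda>s. {x::'a. s < x \<bullet> b})"
    define a where "a = measure lborel (\<Union>\<A>)"
    define a1 where "a1 = measure lborel (\<Union>\<A> \<inter> lo t)"
    define a2 where "a2 = measure lborel (\<Union>\<A> \<inter> hi t)"
    define c where "c = measure lborel (\<Union>\<B>)"
    have split: "measure lborel (\<Union>\<C>) = measure lborel (\<Union>\<C> \<inter> lo s) + measure lborel (\<Union>\<C> \<inter> hi s)"
      if "disjoint_boxes \<C>" for \<C> s
      unfolding lo_def hi_def using that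
      by (intro measure_lborel_hyperplane_cut b disjoint_boxes_borel disjoint_boxes_finite)
    have dlo: "disjoint_boxes (cut_boxes \<C> (lo s))" and dhi: "disjoint_boxes (cut_boxes \<C> (hi s))"
      if "disjoint_boxes \<C>" for \<C> s
      unfolding lo_def hi_def using that b
      by (auto intro!: disjoint_boxes_cut box_Int_lessThan box_Int_greaterThan)
    have finA: "finite \<A>" and finB: "finite \<B>" using dA dB by (auto simp: disjoint_boxes_def)
    have lessA: "card (cut_boxes \<A> (lo t)) < card \<A>" "card (cut_boxes \<A> (hi t)) < card \<A>"
      using Q R finA unfolding lo_def hi_def by (auto intro: card_cut_boxes_less)
    have apos: "a > 0" "c > 0" using pos dA dB ne by (auto simp: a_def c_def)
    \<comment> \<open>A nonempty open set is not contained in a hyperplane, so \<open>R\<close> and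
      \<open>Q\<close> leave a nonempty piece in the lower and the upper half of
      \<open>\<A>\<close>.\<close>
    have meets: "\<exists>x\<in>V. x \<bullet> b \<noteq> t" if V: "open V" "V \<noteq> {}" for V
    proof (rule ccontr)
      assume "\<not> ?thesis"
      then have "V \<subseteq> {x. x \<bullet> b = t}" by auto
      moreover have "interior {x. b \<bullet> x = t} = {}"
        using b nonzero_Basis by (intro interior_hyperplane) auto
      ultimately show False using V by (metis (no_types, lifting) Collect_cong inner_commute interior_maximal subset_empty)
    qed
    have neA: "cut_boxes \<A> (lo t) \<noteq> {}" "cut_boxes \<A> (hi t) \<noteq> {}"
    proof -
      obtain x where "x \<in> R" "x \<bullet> b \<noteq> t" using meets[OF oQR(2) neQR(2)] by blast
      then have "x \<in> \<Union>(cut_boxes \<A> (lo t))" using R by (force simp: Union_cut_boxes lo_def)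
      then show "cut_boxes \<A> (lo t) \<noteq> {}" by blast
      obtain x where "x \<in> Q" "x \<bullet> b \<noteq> t" using meets[OF oQR(1) neQR(1)] by blast
      then have "x \<in> \<Union>(cut_boxes \<A> (hi t))" using Q by (force simp: Union_cut_boxes hi_def)
      then show "cut_boxes \<A> (hi t) \<noteq> {}" by blast
    qed
    have a12: "a1 > 0" "a2 > 0" "a = a1 + a2"
      using pos[OF dlo[OF dA] neA(1)] pos[OF dhi[OF dA] neA(2)] split[OF dA, of t]
      by (auto simp: a1_def a2_def a_def Union_cut_boxes)
    obtain s where s: "measure lborel (\<Union>\<B> \<inter> lo s) = a1 / a * c"
    proof -
      have "0 < a1 / a * c" "a1 / a * c < c" using a12 apos by (auto simp: field_simps)
      from lborel_hyperplane_cut_exists[OF b disjoint_boxes_borel[OF dB] disjoint_boxes_finite[OF dB] this[unfolded c_def]]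
      show ?thesis using that unfolding lo_def c_def by metis
    qed
    have s': "measure lborel (\<Union>\<B> \<inter> hi s) = a2 / a * c"
      using split[OF dB, of s] s a12 apos by (simp add: c_def[symmetric] field_simps)
    have neB: "cut_boxes \<B> (lo s) \<noteq> {}" "cut_boxes \<B> (hi s) \<noteq> {}"
      using s s' a12 apos Union_cut_boxes[of \<B> "lo s"] Union_cut_boxes[of \<B> "hi s"] by auto
    \<comment> \<open>Cutting both volumes in the same ratio makes each half contribute exactly the
      fraction \<open>x / a\<close> of \<open>sqrt (a * c)\<close>. The two fractions add up to 1,
      so the cut costs nothing.\<close>
    have ratio: "sqrt (x * (x / a * c)) = x / a * sqrt (a * c)" if "x > 0" for x
    proof -
      have "x * (x / a * c) = (x / a)\<^sup>2 * (a * c)" using apos by (simp add: field_simps power2_eq_square)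
      then show ?thesis using that apos by (simp only: real_sqrt_mult real_sqrt_abs) simp
    qed
    \<comment> \<open>The cut of \<open>\<B>\<close> need not remove any box; the total count falls
      because that of \<open>\<A>\<close> does.\<close>
    have "P (cut_boxes \<A> (lo t)) (cut_boxes \<B> (lo s))"
      using lessA card_cut_boxes[OF finB] by (intro IH dlo dA dB neA neB add_less_le_mono)
    then have 1: "2 ^ DIM('a) * (a1 / a * sqrt (a * c)) \<le> measure lborel (sumset (\<Union>\<A> \<inter> lo t) (\<Union>\<B> \<inter> lo s))"
      using ratio[of a1] a12 by (simp add: P_def Union_cut_boxes s a1_def[symmetric])
    have "P (cut_boxes \<A> (hi t)) (cut_boxes \<B> (hi s))"
      using lessA card_cut_boxes[OF finB] by (intro IH dhi dA dB neA neB add_less_le_mono)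
    then have 2: "2 ^ DIM('a) * (a2 / a * sqrt (a * c)) \<le> measure lborel (sumset (\<Union>\<A> \<inter> hi t) (\<Union>\<B> \<inter> hi s))"
      using ratio[of a2] a12 by (simp add: P_def Union_cut_boxes s' a2_def[symmetric])
    have fm: "sumset (\<Union>\<A> \<inter> H) (\<Union>\<B> \<inter> H') \<in> fmeasurable lborel" if "open H" for H H'
      using that dA dB
      by (intro open_bounded_fmeasurable open_sumset bounded_sumset)
         (auto intro: disjoint_boxes_open disjoint_boxes_bounded bounded_Int)
    have op: "open (lo s)" "open (hi s)" for s
      unfolding lo_def hi_def by (auto intro: open_halfspace_component_lt open_halfspace_component_gt)
    have "2 ^ DIM('a) * sqrt (a * c) = 2 ^ DIM('a) * (a1 / a * sqrt (a * c)) + 2 ^ DIM('a) * (a2 / a * sqrt (a * c))"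
    proof -
      have "a1 / a + a2 / a = 1" using a12 apos by (simp add: add_divide_distrib[symmetric])
      then show ?thesis by (metis distrib_left distrib_right mult_1)
    qed
    also have "\<dots> \<le> measure lborel (sumset (\<Union>\<A> \<inter> lo t) (\<Union>\<B> \<inter> lo s)) + measure lborel (sumset (\<Union>\<A> \<inter> hi t) (\<Union>\<B> \<inter> hi s))"
      by (intro add_mono 1 2)
    also have "\<dots> = measure lborel (sumset (\<Union>\<A> \<inter> lo t) (\<Union>\<B> \<inter> lo s) \<union> sumset (\<Union>\<A> \<inter> hi t) (\<Union>\<B> \<inter> hi s))"
    proof (rule measure_Union[symmetric])
      \<comment> \<open>Coordinates along \<open>b\<close> add, so the two sums lie on opposite
        sides of the height \<open>t + s\<close>.\<close>
      show "sumset (\<Union>\<A> \<inter> lo t) (\<Union>\<B> \<inter> lo s) \<inter> sumset (\<Union>\<A> \<inter> hi t) (\<Union>\<B> \<inter> hi s) = {}"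
      proof (intro equals0I)
        fix z assume z: "z \<in> sumset (\<Union>\<A> \<inter> lo t) (\<Union>\<B> \<inter> lo s) \<inter> sumset (\<Union>\<A> \<inter> hi t) (\<Union>\<B> \<inter> hi s)"
        have "z \<bullet> b < t + s" using IntD1[OF z] by (auto simp: sumset_def lo_def inner_add_left)
        moreover have "t + s < z \<bullet> b" using IntD2[OF z] by (auto simp: sumset_def hi_def inner_add_left)
        ultimately show False by simp
      qed
    qed (use fm[OF op(1), of t "lo s"] fm[OF op(2), of t "hi s"] in \<open>simp_all add: fmeasurable_def less_top\<close>)
    also have "\<dots> \<le> measure lborel (sumset (\<Union>\<A>) (\<Union>\<B>))"
    proof (rule measure_mono_fmeasurable)
      show "sumset (\<Union>\<A>) (\<Union>\<B>) \<in> fmeasurable lborel" using fm[of UNIV UNIV] by simp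
      show "sumset (\<Union>\<A> \<inter> lo t) (\<Union>\<B> \<inter> lo s) \<union> sumset (\<Union>\<A> \<inter> hi t) (\<Union>\<B> \<inter> hi s) \<in> sets lborel"
        using fm[OF op(1), of t "lo s"] fm[OF op(2), of t "hi s"] by (simp add: fmeasurable_def sets.Un)
      show "sumset (\<Union>\<A> \<inter> lo t) (\<Union>\<B> \<inter> lo s) \<union> sumset (\<Union>\<A> \<inter> hi t) (\<Union>\<B> \<inter> hi s)
         \<subseteq> sumset (\<Union>\<A>) (\<Union>\<B>)"
        unfolding sumset_def by blast
    qed
    finally show ?thesis by (simp add: P_def a_def c_def)
  qed
  have IH: "P \<A>' \<B>'" if "card \<A>' + card \<B>' < card \<A> + card \<B>" "disjoint_boxes \<A>'" "disjoint_boxes \<B>'"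
      "\<A>' \<noteq> {}" "\<B>' \<noteq> {}" for \<A>' \<B>'
    unfolding P_def using less.hyps that by blast
  have comm: "P \<A> \<B> \<longleftrightarrow> P \<B> \<A>" for \<A> \<B>
    by (simp add: P_def sumset_commute[of "\<Union>\<A>"] mult.commute)
  consider "card \<A> \<ge> 2" | "card \<B> \<ge> 2" | "card \<A> = 1" "card \<B> = 1"
  proof -
    have "card \<A> > 0" "card \<B> > 0" using less.prems by (auto simp: disjoint_boxes_def card_gt_0_iff)
    then show thesis using that by linarith
  qed
  then have "P \<A> \<B>"
  proof cases
    case 1
    show ?thesis by (rule step[OF less.prems IH 1])
  next
    case 2
    have "P \<B> \<A>"
    proof (rule step)
      fix \<A>' \<B>' :: "'a set set"
      assume "card \<A>' + card \<B>' < card \<B> + card \<A>" "disjoint_boxes \<A>'" "disjoint_boxes \<B>'"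
         "\<A>' \<noteq> {}" "\<B>' \<noteq> {}"
      then show "P \<A>' \<B>'" using IH[of \<A>' \<B>'] by simp
    qed (fact less.prems 2)+
    then show ?thesis by (simp only: comm[of \<A> \<B>])
  next
    case 3
    then obtain A B where AB: "\<A> = {A}" "\<B> = {B}" by (auto simp: card_1_singleton_iff)
    then obtain l u l' u' where "A = box l u" "B = box l' u'" "A \<noteq> {}" "B \<noteq> {}"
      using less.prems unfolding disjoint_boxes_def by (metis singletonI)
    then show ?thesis using sumset_box_measure[of l u l' u'] by (simp add: P_def AB)
  qed
  then show ?case by (simp add: P_def)
qed

section \<open>Hausdorff measure of full dimension\<close>

lemma unit_ball_vol_eq: "Defs.unit_ball_vol d = Ball_Volume.unit_ball_vol (real d)"
  by (simp add: Defs.unit_ball_vol_def Ball_Volume.unit_ball_vol_def)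

lemma content_cball_unit_ball_vol:
  "r \<ge> 0 \<Longrightarrow> measure lborel (cball c r :: 'a::euclidean_space set) = Defs.unit_ball_vol DIM('a) * r ^ DIM('a)"
  using content_cball[of r c] by (simp add: unit_ball_vol_eq)

section \<open>The isodiametric inequality\<close>

lemma measure_lborel_uminus:
  fixes V :: "'a::euclidean_space set"
  assumes "V \<in> sets borel"
  shows "measure lborel (uminus ` V) = measure lborel V"
proof -
  have im: "uminus ` V = uminus -` V" by (auto simp: image_iff) (metis minus_minus)
  have "lborel = distr lborel borel (uminus :: 'a \<Rightarrow> 'a)"
    using lborel_affine[of "- 1" "0 :: 'a"] by (simp add: density_1 one_ennreal_def[symmetric])
  then have "measure lborel V = measure (distr lborel borel uminus) V" by simp
  also have "\<dots> = measure lborel (uminus -` V)" using assms by (subst measure_distr) auto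
  finally show ?thesis by (simp add: im)
qed

lemma disjoint_boxes_uminus:
  assumes "disjoint_boxes \<A>" shows "disjoint_boxes ((`) uminus ` \<A>)"
proof -
  have box: "uminus ` box l u = box (- u) (- l)" for l u :: 'a
  proof (intro set_eqI)
    fix x :: 'a
    have "x \<in> uminus ` box l u \<longleftrightarrow> - x \<in> box l u" by (metis image_iff minus_minus)
    also have "\<dots> \<longleftrightarrow> x \<in> box (- u) (- l)" by (auto simp: mem_box minus_less_iff less_minus_iff)
    finally show "x \<in> uminus ` box l u \<longleftrightarrow> x \<in> box (- u) (- l)" .
  qed
  show ?thesis
    unfolding disjoint_boxes_def disjoint_def
  proof (intro conjI ballI impI)
    fix A B assume AB: "A \<in> (`) uminus ` \<A>" "B \<in> (`) uminus ` \<A>" "A \<noteq> B"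
    then obtain A' B' where *: "A = uminus ` A'" "B = uminus ` B'" "A' \<in> \<A>" "B' \<in> \<A>" by auto
    then have "A' \<inter> B' = {}"
      using assms AB(3) unfolding disjoint_boxes_def disjoint_def by metis
    then show "A \<inter> B = {}" using * by auto
  next
    fix B assume "B \<in> (`) uminus ` \<A>"
    then obtain B' where "B = uminus ` B'" "B' \<in> \<A>" by auto
    then show "B \<noteq> {}" "\<exists>l u. B = box l u"
      using assms box unfolding disjoint_boxes_def by (auto, metis)
  qed (use assms in \<open>auto simp: disjoint_boxes_def\<close>)
qed

text \<open>Reflection keeps the volume, so the square root reduces to the volume itself and
  \<open>2 ^ DIM('a)\<close> cancels against the ball of radius \<open>D\<close>. Taking any bound
  \<open>D\<close> on distances, instead of the diameter, leaves room for sets that approximate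
  another one from outside.\<close>

lemma isodiametric_disjoint_boxes:
  fixes \<A> :: "'a::euclidean_space set set"
  assumes "disjoint_boxes \<A>" and D: "D \<ge> 0" "\<And>x y. x \<in> \<Union>\<A> \<Longrightarrow> y \<in> \<Union>\<A> \<Longrightarrow> dist x y \<le> D"
  shows "measure lborel (\<Union>\<A>) \<le> Defs.unit_ball_vol DIM('a) * (D / 2) ^ DIM('a)"
proof (cases "\<A> = {}")
  case False
  let ?V = "\<Union>\<A>"
  have un: "\<Union>((`) uminus ` \<A>) = uminus ` ?V" by auto
  have "2 ^ DIM('a) * sqrt (measure lborel ?V * measure lborel (uminus ` ?V)) \<le> measure lborel (sumset ?V (uminus ` ?V))"
    using sumset_disjoint_boxes_measure[OF assms(1) disjoint_boxes_uminus[OF assms(1)]] False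
    unfolding un by simp
  also have "\<dots> \<le> measure lborel (cball (0::'a) D)"
  proof (rule measure_mono_fmeasurable)
    show "sumset ?V (uminus ` ?V) \<subseteq> cball 0 D"
      using D(2) by (force simp: sumset_def dist_norm norm_minus_commute)
    show "sumset ?V (uminus ` ?V) \<in> sets lborel"
      using open_sumset[OF disjoint_boxes_open[OF assms(1)]] by simp
    show "cball (0::'a) D \<in> fmeasurable lborel"
      using emeasure_bounded_finite[of "cball (0::'a) D"] by (intro fmeasurableI) auto
  qed
  also have "\<dots> = 2 ^ DIM('a) * (Defs.unit_ball_vol DIM('a) * (D / 2) ^ DIM('a))"
    using D(1) by (simp add: content_cball_unit_ball_vol power_divide)
  finally show ?thesis
    by (simp add: measure_lborel_uminus[OF disjoint_boxes_borel[OF assms(1)]])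
qed (use D unit_ball_vol_nonneg in auto)

text \<open>Pieces of a box covering that stay within \<open>e\<close> of points of \<open>S\<close>
  have mutual distances at most \<open>diameter S + 2 * e\<close>. The bound for finite subfamilies
  passes to the countable covering by monotone limits.\<close>

lemma isodiametric_inequality_approx:
  fixes S :: "'a::euclidean_space set"
  assumes S: "bounded S" "S \<noteq> {}" "S \<in> sets borel" and e: "e > 0"
  shows "emeasure lborel S \<le> ennreal (Defs.unit_ball_vol DIM('a) * ((diameter S + 2 * e) / 2) ^ DIM('a))"
proof -
  obtain a where a: "S \<subseteq> box (- a) a" using bounded_subset_box_symmetric[OF S(1)] by blast
  have cov: "S \<subseteq> cbox (- a) a" "box (- a) a \<noteq> {}" "gauge (\<lambda>x. ball x e)"
    using a box_subset_cbox S(2) gauge_ball[OF e] by blast+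
  obtain \<D> where D: "countable \<D>" "\<And>K. K \<in> \<D> \<Longrightarrow> interior K \<noteq> {} \<and> (\<exists>c d. K = cbox c d)"
      "pairwise (\<lambda>A B. interior A \<inter> interior B = {}) \<D>"
      "\<And>K. K \<in> \<D> \<Longrightarrow> \<exists>x \<in> S \<inter> K. K \<subseteq> ball x e" "S \<subseteq> \<Union>\<D>"
    by (rule covering_lemma[OF cov]) (rule that; assumption)
  let ?bound = "ennreal (Defs.unit_ball_vol DIM('a) * ((diameter S + 2 * e) / 2) ^ DIM('a))"
  \<comment> \<open>The box inequality needs disjoint open boxes. The interiors of finitely many
    pieces are such boxes, and they have the same volumes as the pieces.\<close>
  have fin: "emeasure lborel (\<Union>F) \<le> ?bound" if F: "finite F" "F \<subseteq> \<D>" for F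
  proof -
    have box: "\<exists>l u. K = cbox l u \<and> interior K = box l u" if K: "K \<in> F" for K
    proof -
      obtain l u where "K = cbox l u" using D(2)[of K] F K by blast
      then show ?thesis by (metis interior_cbox)
    qed
    have disj: "interior K \<inter> interior L = {}" if "K \<in> F" "L \<in> F" "K \<noteq> L" for K L
      using D(3) F that by (auto simp: pairwise_def)
    have dA: "disjoint_boxes (interior ` F)"
      unfolding disjoint_boxes_def disjoint_def
    proof (intro conjI ballI impI)
      fix B assume "B \<in> interior ` F"
      then obtain K where "K \<in> F" "B = interior K" by blast
      then show "B \<noteq> {}" "\<exists>l u. B = box l u" using D(2)[of K] F box[of K] by auto
    next
      fix A B assume "A \<in> interior ` F" "B \<in> interior ` F" "A \<noteq> B"
      then show "A \<inter> B = {}" using disj by blast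
    qed (use F in auto)
    have near: "dist x y \<le> diameter S + 2 * e" if xy: "x \<in> \<Union>(interior ` F)" "y \<in> \<Union>(interior ` F)" for x y
    proof -
      have *: "\<exists>z\<in>S. dist z x < e" if x: "x \<in> \<Union>(interior ` F)" for x
      proof -
        obtain K where "K \<in> F" "x \<in> K" using x interior_subset by blast
        then obtain z where "z \<in> S" "K \<subseteq> ball z e" using D(4)[of K] F by blast
        then show ?thesis using \<open>x \<in> K\<close> by (meson mem_ball subsetD)
      qed
      obtain z w where zw: "z \<in> S" "w \<in> S" "dist z x < e" "dist w y < e" using * xy by meson
      have "dist z w \<le> diameter S" using diameter_bounded_bound[OF S(1)] zw by auto
      moreover have "dist x y \<le> dist z x + dist z w + dist w y"
        by (smt (verit) dist_triangle dist_commute)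
      ultimately show ?thesis using zw by linarith
    qed
    have sets: "K \<in> sets lborel" if "K \<in> F" for K using box[OF that] by auto
    have "emeasure lborel (\<Union>F) \<le> (\<Sum>K\<in>F. emeasure lborel K)"
      using emeasure_subadditive_finite[of F "\<lambda>K. K" lborel] F sets by auto
    also have "\<dots> = (\<Sum>K\<in>F. emeasure lborel (interior K))"
      using box by (intro sum.cong refl) (metis emeasure_lborel_box_eq emeasure_lborel_cbox_eq)
    also have "\<dots> = emeasure lborel (\<Union>(interior ` F))"
      using disj F by (intro sum_emeasure) (auto simp: disjoint_family_on_def)
    also have "\<dots> = ennreal (measure lborel (\<Union>(interior ` F)))"
      using disjoint_boxes_finite[OF dA] by (intro emeasure_eq_ennreal_measure) auto
    also have "\<dots> \<le> ?bound"
      using near e diameter_ge_0[OF S(1)] by (intro ennreal_leI isodiametric_disjoint_boxes dA) auto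
    finally show ?thesis .
  qed
  have neD: "\<D> \<noteq> {}" using D(5) S(2) by auto
  define U where "U = (\<lambda>n. \<Union>(from_nat_into \<D> ` {..<n}))"
  have "from_nat_into \<D> ` {..<n} \<subseteq> \<D>" for n using from_nat_into[OF neD] by auto
  then have Ub: "emeasure lborel (U n) \<le> ?bound" for n unfolding U_def by (intro fin) auto
  have "K \<in> sets lborel" if "K \<in> \<D>" for K using D(2)[OF that] by auto
  then have Us: "U n \<in> sets lborel" for n
    unfolding U_def using from_nat_into[OF neD] by (intro sets.finite_Union) auto
  have "\<Union>\<D> = (\<Union>n. U n)"
  proof -
    have "(\<Union>n. U n) = \<Union>(range (from_nat_into \<D>))" unfolding U_def by blast
    then show ?thesis using range_from_nat_into[OF neD D(1)] by simp
  qed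
  then have "emeasure lborel S \<le> emeasure lborel (\<Union>n. U n)"
    using D(5) Us by (intro emeasure_mono) auto
  also have "\<dots> = (SUP n. emeasure lborel (U n))"
  proof (rule SUP_emeasure_incseq[symmetric])
    show "incseq U" unfolding incseq_def U_def by (intro allI impI Union_mono image_mono) auto
  qed (use Us in auto)
  also have "\<dots> \<le> ?bound" using Ub by (intro SUP_least)
  finally show ?thesis .
qed

lemma isodiametric_inequality:
  fixes S :: "'a::euclidean_space set"
  assumes S: "bounded S" "S \<in> sets borel"
  shows "emeasure lborel S \<le> hausdorff_cost DIM('a) S"
proof (cases "S = {}")
  case False
  let ?f = "\<lambda>e. Defs.unit_ball_vol DIM('a) * ((diameter S + 2 * e) / 2) ^ DIM('a)"
  have "(\<lambda>n. ?f (inverse (real (Suc n)))) \<longlonglongrightarrow> ?f 0"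
    by (intro tendsto_intros LIMSEQ_inverse_real_of_nat) auto
  then have "(\<lambda>n. ennreal (?f (inverse (real (Suc n))))) \<longlonglongrightarrow> ennreal (?f 0)"
    by (rule tendsto_ennrealI)
  then have "emeasure lborel S \<le> ennreal (?f 0)"
    by (rule LIMSEQ_le_const) (use isodiametric_inequality_approx[OF S(1) False S(2)] in auto)
  then show ?thesis using False by (simp add: hausdorff_cost_def)
qed simp

section \<open>Comparison of Hausdorff and Lebesgue measure in full dimension\<close>

lemma lborel_le_hausdorff_pre:
  fixes A :: "'a::euclidean_space set"
  assumes "A \<in> sets borel"
  shows "emeasure lborel A \<le> hausdorff_pre DIM('a) \<delta> A"
proof (rule le_hausdorff_pre)
  fix C :: "nat \<Rightarrow> 'a set"
  assume C: "A \<subseteq> (\<Union>i. C i)" "\<And>i. bounded (C i)"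
  \<comment> \<open>Members of a cover are arbitrary sets. Their closures are Borel and have the
    same diameter, hence the same cost.\<close>
  have "emeasure lborel A \<le> emeasure lborel (\<Union>i. closure (C i))"
    using C(1) closure_subset by (intro emeasure_mono) (blast, auto)
  also have "\<dots> \<le> (\<Sum>i. emeasure lborel (closure (C i)))"
    by (intro emeasure_subadditive_countably) auto
  also have "\<dots> \<le> (\<Sum>i. hausdorff_cost DIM('a) (closure (C i)))"
    using C(2) by (intro suminf_le isodiametric_inequality summableI bounded_closure) auto
  also have "\<dots> = (\<Sum>i. hausdorff_cost DIM('a) (C i))"
    by (simp add: hausdorff_cost_def diameter_closure[OF C(2)] cong: if_cong)
  finally show "emeasure lborel A \<le> (\<Sum>i. hausdorff_cost DIM('a) (C i))" .
qed

text \<open>Balls are the equality case of the isodiametric inequality, which is why coverings by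
  balls attain Lebesgue measure.\<close>

lemma hausdorff_cost_cball:
  fixes x :: "'a::euclidean_space"
  assumes "r > 0"
  shows "hausdorff_cost DIM('a) (cball x r) = emeasure lborel (cball x r)"
proof -
  have "emeasure lborel (cball x r) = ennreal (measure lborel (cball x r))"
    using emeasure_bounded_finite[of "cball x r"] by (intro emeasure_eq_ennreal_measure) auto
  then show ?thesis
    using assms by (simp add: hausdorff_cost_def content_cball_unit_ball_vol)
qed

text \<open>Vitali families are countable sets of centre-radius pairs, possibly finite. A sum
  written as an integral over \<open>count_space\<close> fits them and matches
  \<open>emeasure_UN_countable\<close>.\<close>

lemma hausdorff_pre_UN_countable:
  assumes "countable I" "\<delta> \<ge> 0"
  shows "hausdorff_pre d \<delta> (\<Union>i\<in>I. A i) \<le> (\<integral>\<^sup>+i. hausdorff_pre d \<delta> (A i) \<partial>count_space I)"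
proof -
  let ?N = "to_nat_on I ` I"
  define B where "B = (\<lambda>n. if n \<in> ?N then A (from_nat_into I n) else {})"
  have "(\<Union>i\<in>I. A i) = (\<Union>n. B n)"
    using assms(1) by (auto simp: B_def split: if_splits) 
  then have "hausdorff_pre d \<delta> (\<Union>i\<in>I. A i) \<le> (\<Sum>n. hausdorff_pre d \<delta> (B n))"
    by (simp add: hausdorff_pre_countably_subadditive)
  also have "\<dots> = (\<integral>\<^sup>+n. hausdorff_pre d \<delta> (B n) \<partial>count_space UNIV)"
    by (rule nn_integral_count_space_nat[symmetric])
  also have "\<dots> = (\<integral>\<^sup>+n. hausdorff_pre d \<delta> (A (from_nat_into I n)) * indicator ?N n \<partial>count_space UNIV)"
    by (intro nn_integral_cong) (auto simp: B_def hausdorff_pre_empty assms(2))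
  also have "\<dots> = (\<integral>\<^sup>+n. hausdorff_pre d \<delta> (A (from_nat_into I n)) \<partial>count_space ?N)"
    by (rule nn_integral_count_space_indicator[symmetric]) simp
  also have "\<dots> = (\<integral>\<^sup>+i. hausdorff_pre d \<delta> (A (from_nat_into I (to_nat_on I i))) \<partial>count_space I)"
    using assms(1) by (intro nn_integral_bij_count_space[symmetric] inj_on_imp_bij_betw inj_on_to_nat_on)
  also have "\<dots> = (\<integral>\<^sup>+i. hausdorff_pre d \<delta> (A i) \<partial>count_space I)"
    using assms(1) by (intro nn_integral_cong) auto
  finally show ?thesis .
qed

text \<open>Disposes of the null set that a Vitali covering leaves over; here a lossy constant is
  harmless. Disjoint balls inside an open set of tiny volume cover \<open>N\<close> once they are
  enlarged five times, at \<open>5 ^ DIM('a)\<close> times their volume.\<close>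

lemma hausdorff_pre_null:
  fixes N :: "'a::euclidean_space set"
  assumes N: "N \<in> null_sets lborel" and "\<delta> > 0"
  shows "hausdorff_pre DIM('a) \<delta> N = 0"
proof -
  have "hausdorff_pre DIM('a) \<delta> N \<le> 0 + ennreal e" if "e > 0" for e
  proof -
    obtain U where U: "open U" "N \<subseteq> U" "emeasure lborel (U - N) < e / 5 ^ DIM('a)"
      using outer_regular_lborel[of N "e / 5 ^ DIM('a)"] null_setsD2[OF N] \<open>e > 0\<close> by auto
    have Ue: "emeasure lborel U < e / 5 ^ DIM('a)"
      using U N emeasure_Diff_null_set[of N lborel U] by simp
    \<comment> \<open>A radius of at most \<open>\<delta> / 10\<close> keeps the diameter of the
      ball enlarged five times below \<open>\<delta>\<close>.\<close>
    define K where "K = {(x, r). 0 < r \<and> r \<le> \<delta> / 10 \<and> cball x r \<subseteq> U}"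
    have cov: "N \<subseteq> (\<Union>i\<in>K. cball (fst i) (snd i))"
    proof
      fix x assume "x \<in> N"
      then obtain r where r: "r > 0" "cball x r \<subseteq> U" using U open_contains_cball by blast
      then have "(x, min r (\<delta> / 10)) \<in> K" using \<open>\<delta> > 0\<close> by (auto simp: K_def)
      then show "x \<in> (\<Union>i\<in>K. cball (fst i) (snd i))" using r \<open>\<delta> > 0\<close> by (intro UN_I) auto
    qed
    have Kr: "\<And>i. i \<in> K \<Longrightarrow> 0 < snd i \<and> snd i \<le> \<delta> / 10" by (auto simp: K_def)
    obtain C where C: "countable C" "C \<subseteq> K"
        "pairwise (\<lambda>i j. disjnt (cball (fst i) (snd i)) (cball (fst j) (snd j))) C"
        "N \<subseteq> (\<Union>i\<in>C. cball (fst i) (5 * snd i))"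
      by (rule Vitali_covering_lemma_cballs[OF cov Kr]) (assumption | rule that)+
    have disj: "disjoint_family_on (\<lambda>i. cball (fst i) (snd i)) C"
      using C(3) by (auto simp: disjoint_family_on_def pairwise_def disjnt_def)
    have five: "hausdorff_pre DIM('a) \<delta> (cball (fst i) (5 * snd i)) \<le> 5 ^ DIM('a) * emeasure lborel (cball (fst i) (snd i))"
      if "i \<in> C" for i
    proof -
      have r: "0 < snd i" "snd i \<le> \<delta> / 10" using C(2) that by (auto simp: K_def)
      then have "hausdorff_pre DIM('a) \<delta> (cball (fst i) (5 * snd i)) \<le> hausdorff_cost DIM('a) (cball (fst i) (5 * snd i))"
        using \<open>\<delta> > 0\<close> by (intro hausdorff_pre_le_cost) auto
      also have "\<dots> = ennreal (5 ^ DIM('a) * (Defs.unit_ball_vol DIM('a) * snd i ^ DIM('a)))"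
        using r by (simp add: hausdorff_cost_def power_mult_distrib mult_ac)
      also have "\<dots> = 5 ^ DIM('a) * hausdorff_cost DIM('a) (cball (fst i) (snd i))"
        using r unit_ball_vol_nonneg[of "DIM('a)"]
        by (subst ennreal_mult) (auto simp: hausdorff_cost_def ennreal_power[symmetric])
      finally show ?thesis using r by (simp add: hausdorff_cost_cball)
    qed
    have "hausdorff_pre DIM('a) \<delta> N \<le> hausdorff_pre DIM('a) \<delta> (\<Union>i\<in>C. cball (fst i) (5 * snd i))"
      by (rule hausdorff_pre_mono[OF C(4)])
    also have "\<dots> \<le> (\<integral>\<^sup>+i. hausdorff_pre DIM('a) \<delta> (cball (fst i) (5 * snd i)) \<partial>count_space C)"
      using \<open>\<delta> > 0\<close> C(1) by (intro hausdorff_pre_UN_countable) auto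
    also have "\<dots> \<le> (\<integral>\<^sup>+i. 5 ^ DIM('a) * emeasure lborel (cball (fst i) (snd i)) \<partial>count_space C)"
      using five by (intro nn_integral_mono) auto
    also have "\<dots> = 5 ^ DIM('a) * (\<integral>\<^sup>+i. emeasure lborel (cball (fst i) (snd i)) \<partial>count_space C)"
      by (rule nn_integral_cmult) auto
    also have "\<dots> = 5 ^ DIM('a) * emeasure lborel (\<Union>i\<in>C. cball (fst i) (snd i))"
      using disj C(1) by (subst emeasure_UN_countable) auto
    also have "\<dots> \<le> 5 ^ DIM('a) * emeasure lborel U"
    proof (intro mult_left_mono emeasure_mono UN_least)
      fix i assume "i \<in> C"
      then show "cball (fst i) (snd i) \<subseteq> U" using C(2) unfolding K_def by fastforce
    qed (use U(1) in auto)
    also have "\<dots> \<le> 5 ^ DIM('a) * ennreal (e / 5 ^ DIM('a))"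
      using Ue by (intro mult_left_mono) auto
    also have "\<dots> = ennreal (5 ^ DIM('a) * (e / 5 ^ DIM('a)))"
      using that by (subst ennreal_mult) (auto simp: ennreal_power[symmetric])
    finally show ?thesis by simp
  qed
  then have "hausdorff_pre DIM('a) \<delta> N \<le> 0" by (rule ennreal_le_epsilon)
  then show ?thesis by (simp only: le_zero_eq)
qed

text \<open>Disjoint balls of diameter at most \<open>\<delta>\<close> inside \<open>U\<close> fill
  it up to a null set, and each costs exactly its volume. This gives the sharp constant that the
  enlarged balls of the previous lemma miss.\<close>

lemma hausdorff_pre_le_lborel_open:
  fixes U :: "'a::euclidean_space set"
  assumes "open U" and "\<delta> > 0"
  shows "hausdorff_pre DIM('a) \<delta> U \<le> emeasure lborel U"
proof -
  define K where "K = {(x, r). 0 < r \<and> r \<le> \<delta> / 2 \<and> cball x r \<subseteq> U}"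
  have fine: "\<exists>i. i \<in> K \<and> x \<in> cball (fst i) (snd i) \<and> snd i < e" if xe: "x \<in> U" "0 < e" for x e
  proof -
    obtain r where r: "r > 0" "cball x r \<subseteq> U" using assms xe open_contains_cball by blast
    then have "(x, min r (min (e / 2) (\<delta> / 2))) \<in> K" using assms that by (auto simp: K_def)
    then show ?thesis using r assms that by (intro exI[of _ "(x, min r (min (e / 2) (\<delta> / 2)))"]) auto
  qed
  have Kr: "0 < snd i" if "i \<in> K" for i using that by (auto simp: K_def)
  obtain C where C: "countable C" "C \<subseteq> K"
      "pairwise (\<lambda>i j. disjnt (cball (fst i) (snd i)) (cball (fst j) (snd j))) C"
      "negligible (U - (\<Union>i\<in>C. cball (fst i) (snd i)))"
    by (rule Vitali_covering_theorem_cballs[OF Kr fine]) (assumption | rule that)+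
  let ?V = "\<Union>i\<in>C. cball (fst i) (snd i)"
  have disj: "disjoint_family_on (\<lambda>i. cball (fst i) (snd i)) C"
    using C(3) by (auto simp: disjoint_family_on_def pairwise_def disjnt_def)
  have "?V \<in> sets borel" using C(1) by (intro sets.countable_UN') auto
  then have null: "U - ?V \<in> null_sets lborel"
    using C(4) assms by (auto simp: negligible_iff_null_sets null_sets_completion_iff)
  have "hausdorff_pre DIM('a) \<delta> U \<le> hausdorff_pre DIM('a) \<delta> (\<Union>b. if b then ?V else U - ?V)"
    by (intro hausdorff_pre_mono) auto
  also have "\<dots> \<le> (\<integral>\<^sup>+b. hausdorff_pre DIM('a) \<delta> (if b then ?V else U - ?V) \<partial>count_space UNIV)"
    using assms by (intro hausdorff_pre_UN_countable) auto
  also have "\<dots> = hausdorff_pre DIM('a) \<delta> ?V"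
    using hausdorff_pre_null[OF null assms(2)]
    by (subst nn_integral_count_space_finite) (auto simp: UNIV_bool)
  also have "\<dots> \<le> (\<integral>\<^sup>+i. hausdorff_pre DIM('a) \<delta> (cball (fst i) (snd i)) \<partial>count_space C)"
    using assms C(1) by (intro hausdorff_pre_UN_countable) auto
  also have "\<dots> \<le> (\<integral>\<^sup>+i. emeasure lborel (cball (fst i) (snd i)) \<partial>count_space C)"
  proof (intro nn_integral_mono)
    fix i assume "i \<in> space (count_space C)"
    then have r: "0 < snd i" "snd i \<le> \<delta> / 2" using C(2) by (auto simp: K_def)
    then show "hausdorff_pre DIM('a) \<delta> (cball (fst i) (snd i)) \<le> emeasure lborel (cball (fst i) (snd i))"
      using assms by (subst hausdorff_cost_cball[symmetric]) (auto intro!: hausdorff_pre_le_cost)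
  qed
  also have "\<dots> = emeasure lborel ?V"
    using disj C(1) by (subst emeasure_UN_countable) auto
  also have "\<dots> \<le> emeasure lborel U"
  proof (intro emeasure_mono UN_least)
    fix i assume "i \<in> C"
    then show "cball (fst i) (snd i) \<subseteq> U" using C(2) unfolding K_def by fastforce
  qed (use assms(1) in auto)
  finally show ?thesis .
qed

lemma hausdorff_outer_eq_lborel:
  fixes A :: "'a::euclidean_space set"
  assumes A: "A \<in> sets borel"
  shows "hausdorff_outer DIM('a) A = emeasure lborel A"
proof (rule antisym)
  show "emeasure lborel A \<le> hausdorff_outer DIM('a) A"
    using lborel_le_hausdorff_pre[OF A, of 1] hausdorff_pre_le_outer[of 1 "DIM('a)" A] by simp
  show "hausdorff_outer DIM('a) A \<le> emeasure lborel A"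
  proof (rule ennreal_le_epsilon)
    fix e :: real assume "e > 0"
    then obtain U where U: "open U" "A \<subseteq> U" "emeasure lborel (U - A) < e"
      using outer_regular_lborel[OF A] by blast
    have "hausdorff_outer DIM('a) A \<le> hausdorff_outer DIM('a) U"
      by (rule hausdorff_outer_mono[OF U(2)])
    also have "\<dots> \<le> emeasure lborel U"
      by (intro hausdorff_outer_leI hausdorff_pre_le_lborel_open U)
    also have "U = A \<union> (U - A)" using U by auto
    also have "emeasure lborel \<dots> \<le> emeasure lborel A + emeasure lborel (U - A)"
      using A U by (intro emeasure_subadditive) auto
    also have "\<dots> \<le> emeasure lborel A + e" using U by (intro add_left_mono) auto
    finally show "hausdorff_outer DIM('a) A \<le> emeasure lborel A + e" .
  qed
qed

section \<open>Similarities and subspaces\<close>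

text \<open>The measure before completion, where values on Borel sets can be computed from the outer
  measure.\<close>

definition hausdorff_borel :: "nat \<Rightarrow> 'a::euclidean_space measure" where
  "hausdorff_borel d = measure_of UNIV (sets borel) (hausdorff_outer d)"

lemma hausdorff_measure_eq: "hausdorff_measure d = completion (hausdorff_borel d)"
  by (simp add: hausdorff_measure_def hausdorff_borel_def)

lemma sets_hausdorff_borel [simp, measurable_cong]: "sets (hausdorff_borel d) = sets borel"
proof -
  have "sets (hausdorff_borel d :: 'a measure) = sigma_sets UNIV (sets borel)"
    unfolding hausdorff_borel_def by (rule sets_measure_of) auto
  also have "\<dots> = sets borel" by (metis sets.sigma_sets_eq space_borel)
  finally show ?thesis .
qed

lemma space_hausdorff_borel [simp]: "space (hausdorff_borel d) = UNIV"
  by (metis sets_eq_imp_space_eq sets_hausdorff_borel space_borel)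

lemma emeasure_hausdorff_borel:
  "A \<in> sets borel \<Longrightarrow> emeasure (hausdorff_borel d) A = hausdorff_outer d A"
  unfolding hausdorff_borel_def by (rule emeasure_measure_of_hausdorff_outer)

text \<open>The Lipschitz condition is imposed on \<open>A\<close> only, so that the inverse of a
  similarity, controlled only on its range, is covered as well.\<close>

lemma hausdorff_outer_lipschitz_image:
  fixes g :: "'a::metric_space \<Rightarrow> 'b::metric_space"
  assumes "L > 0" and lip: "\<And>x y. x \<in> A \<Longrightarrow> y \<in> A \<Longrightarrow> dist (g x) (g y) \<le> L * dist x y"
  shows "hausdorff_outer d (g ` A) \<le> ennreal (L ^ d) * hausdorff_outer d A"
proof (rule hausdorff_outer_leI)
  fix \<delta> :: real assume "\<delta> > 0"
  \<comment> \<open>A cover at scale \<open>\<delta> / L\<close> is mapped to one at scale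
    \<open>\<delta>\<close>. The factor is put on the left because \<open>le_hausdorff_pre\<close>
    compares with the bare sum over a cover.\<close>
  have "ennreal (1 / L ^ d) * hausdorff_pre d \<delta> (g ` A) \<le> hausdorff_pre d (\<delta> / L) A"
  proof (rule le_hausdorff_pre)
    fix C :: "nat \<Rightarrow> 'a set"
    assume C: "A \<subseteq> (\<Union>i. C i)" "\<And>i. bounded (C i)" "\<And>i. diameter (C i) \<le> \<delta> / L"
    have gb: "dist x y \<le> L * diameter (C i)" if xy: "x \<in> g ` (C i \<inter> A)" "y \<in> g ` (C i \<inter> A)" for i x y
    proof -
      obtain u v where uv: "x = g u" "y = g v" "u \<in> C i" "u \<in> A" "v \<in> C i" "v \<in> A" using xy by auto
      have "dist u v \<le> diameter (C i)" using diameter_bounded_bound[OF C(2)] uv by auto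
      then have "L * dist u v \<le> L * diameter (C i)" using \<open>L > 0\<close> by simp
      then show ?thesis using lip[of u v] uv by simp
    qed
    have gbd: "bounded (g ` (C i \<inter> A))" for i
      unfolding bounded_two_points using gb by blast
    have gd: "diameter (g ` (C i \<inter> A)) \<le> L * diameter (C i)" for i
    proof (cases "C i \<inter> A = {}")
      case True
      then show ?thesis using \<open>L > 0\<close> diameter_ge_0[OF C(2)[of i]] by simp
    next
      case False
      then have "(SUP (x, y)\<in>g ` (C i \<inter> A) \<times> g ` (C i \<inter> A). dist x y) \<le> L * diameter (C i)"
        using gb by (intro cSUP_least) auto
      then show ?thesis using False unfolding diameter_def[of "g ` (C i \<inter> A)"] by simp
    qed
    have cost: "hausdorff_cost d (g ` (C i \<inter> A)) \<le> ennreal (L ^ d) * hausdorff_cost d (C i)" for i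
    proof -
      have "hausdorff_cost d (g ` (C i \<inter> A)) \<le> ennreal (if C i = {} then 0 else unit_ball_vol d * (L * diameter (C i) / 2) ^ d)"
        unfolding hausdorff_cost_def
        using gd[of i] diameter_ge_0[OF gbd[of i]] unit_ball_vol_nonneg[of d] \<open>L > 0\<close> diameter_ge_0[OF C(2)[of i]]
        by (intro ennreal_leI) (auto intro!: mult_left_mono power_mono)
      also have "\<dots> = ennreal (L ^ d) * hausdorff_cost d (C i)"
        unfolding hausdorff_cost_def using \<open>L > 0\<close>
        by (subst ennreal_mult'[symmetric]) (auto simp: power_mult_distrib power_divide intro!: arg_cong[of _ _ ennreal])
      finally show ?thesis .
    qed
    have "hausdorff_pre d \<delta> (g ` A) \<le> (\<Sum>i. hausdorff_cost d (g ` (C i \<inter> A)))"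
    proof (rule hausdorff_pre_le_suminf[OF _ gbd])
      show "g ` A \<subseteq> (\<Union>i. g ` (C i \<inter> A))" using C(1) by blast
      show "diameter (g ` (C i \<inter> A)) \<le> \<delta>" for i
        using gd[of i] mult_left_mono[OF C(3)[of i], of L] \<open>L > 0\<close> by simp
    qed
    also have "\<dots> \<le> (\<Sum>i. ennreal (L ^ d) * hausdorff_cost d (C i))"
      by (intro suminf_le cost summableI)
    also have "\<dots> = ennreal (L ^ d) * (\<Sum>i. hausdorff_cost d (C i))" by simp
    finally have "ennreal (1 / L ^ d) * hausdorff_pre d \<delta> (g ` A)
        \<le> ennreal (1 / L ^ d) * (ennreal (L ^ d) * (\<Sum>i. hausdorff_cost d (C i)))"
      by (rule mult_left_mono) simp
    also have "\<dots> = ennreal (1 / L ^ d * L ^ d) * (\<Sum>i. hausdorff_cost d (C i))"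
      using \<open>L > 0\<close> by (subst ennreal_mult') (auto simp: mult.assoc)
    also have "\<dots> = (\<Sum>i. hausdorff_cost d (C i))" using \<open>L > 0\<close> by simp
    finally show "ennreal (1 / L ^ d) * hausdorff_pre d \<delta> (g ` A) \<le> (\<Sum>i. hausdorff_cost d (C i))" .
  qed
  also have "\<dots> \<le> hausdorff_outer d A" using \<open>L > 0\<close> \<open>\<delta> > 0\<close> by (intro hausdorff_pre_le_outer) simp
  finally have "ennreal (L ^ d) * (ennreal (1 / L ^ d) * hausdorff_pre d \<delta> (g ` A)) \<le> ennreal (L ^ d) * hausdorff_outer d A"
    by (rule mult_left_mono) simp
  moreover have "ennreal (L ^ d) * (ennreal (1 / L ^ d) * hausdorff_pre d \<delta> (g ` A))
      = ennreal (L ^ d * (1 / L ^ d)) * hausdorff_pre d \<delta> (g ` A)"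
    using \<open>L > 0\<close> by (subst ennreal_mult') (auto simp: mult.assoc)
  ultimately show "hausdorff_pre d \<delta> (g ` A) \<le> ennreal (L ^ d) * hausdorff_outer d A"
    using \<open>L > 0\<close> by simp
qed

text \<open>The Lipschitz bound is used for \<open>g\<close> and for its inverse on the range. As
  \<open>g\<close> need not be onto, isometric embeddings of lower-dimensional spaces are
  included.\<close>

lemma hausdorff_outer_similarity_image:
  fixes g :: "'a::metric_space \<Rightarrow> 'b::metric_space"
  assumes "r > 0" and sim: "\<And>x y. dist (g x) (g y) = r * dist x y"
  shows "hausdorff_outer d (g ` A) = ennreal (r ^ d) * hausdorff_outer d A"
proof (rule antisym)
  show "hausdorff_outer d (g ` A) \<le> ennreal (r ^ d) * hausdorff_outer d A"
    using assms by (intro hausdorff_outer_lipschitz_image) auto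
  have inj: "inj g" by (rule injI) (metis sim \<open>r > 0\<close> dist_eq_0_iff mult_eq_0_iff less_irrefl)
  have "hausdorff_outer d (inv g ` g ` A) \<le> ennreal ((1 / r) ^ d) * hausdorff_outer d (g ` A)"
  proof (rule hausdorff_outer_lipschitz_image)
    fix x y assume "x \<in> g ` A" "y \<in> g ` A"
    then show "dist (inv g x) (inv g y) \<le> 1 / r * dist x y"
      using sim inj \<open>r > 0\<close> by auto
  qed (use \<open>r > 0\<close> in auto)
  also have "inv g ` g ` A = A" using inj by (simp add: image_comp)
  finally have "ennreal (r ^ d) * hausdorff_outer d A \<le> ennreal (r ^ d) * (ennreal ((1 / r) ^ d) * hausdorff_outer d (g ` A))"
    by (rule mult_left_mono) simp
  also have "\<dots> = ennreal (r ^ d * (1 / r) ^ d) * hausdorff_outer d (g ` A)"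
    using \<open>r > 0\<close> by (subst ennreal_mult') (auto simp: mult.assoc)
  also have "\<dots> = hausdorff_outer d (g ` A)" using \<open>r > 0\<close> by (simp add: power_divide)
  finally show "ennreal (r ^ d) * hausdorff_outer d A \<le> hausdorff_outer d (g ` A)" .
qed

lemma hausdorff_borel_affine:
  fixes x :: "'a::euclidean_space"
  assumes "h > 0"
  shows "hausdorff_borel d = density (distr (hausdorff_borel d) borel (\<lambda>y. x + h *\<^sub>R y)) (\<lambda>_. ennreal (h ^ d))"
proof (rule measure_eqI)
  fix A assume "A \<in> sets (hausdorff_borel d :: 'a measure)"
  then have A: "A \<in> sets borel" by simp
  let ?T = "\<lambda>y. x + h *\<^sub>R y"
  have surj: "y = ?T ((1 / h) *\<^sub>R (y - x))" for y using \<open>h > 0\<close> by simp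
  have "surj ?T" using surj by (rule surjI[OF sym])
  then have A_eq: "?T ` (?T -` A) = A" by (rule surj_image_vimage_eq)
  have meas: "?T -` A \<in> sets borel" using measurable_sets[of ?T borel borel A] A by simp
  have "hausdorff_outer d (?T ` (?T -` A)) = ennreal (h ^ d) * hausdorff_outer d (?T -` A)"
    using \<open>h > 0\<close> by (intro hausdorff_outer_similarity_image) (auto simp: dist_norm scaleR_diff_right[symmetric])
  then have "emeasure (hausdorff_borel d) A = ennreal (h ^ d) * emeasure (hausdorff_borel d) (?T -` A)"
    unfolding A_eq using A meas by (simp only: emeasure_hausdorff_borel)
  then show "emeasure (hausdorff_borel d) A = emeasure (density (distr (hausdorff_borel d) borel ?T) (\<lambda>_. ennreal (h ^ d))) A"
    using A by (simp add: emeasure_density nn_integral_cmult emeasure_distr)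
qed simp

text \<open>The integrands contain \<open>p\<close> and the indicator of \<open>\<Omega>\<close>,
  which are measurable only for the completed measure, so the Borel version of the scaling law does
  not apply to them.\<close>

lemma
  fixes x :: "'a::euclidean_space"
  assumes "h > 0"
  defines "T \<equiv> (\<lambda>y. x + h *\<^sub>R y)"
  shows hausdorff_measure_affine:
      "hausdorff_measure d = density (distr (hausdorff_measure d) (hausdorff_measure d) T) (\<lambda>_. ennreal (h ^ d))"
    and hausdorff_affine_measurable: "T \<in> hausdorff_measure d \<rightarrow>\<^sub>M hausdorff_measure d"
proof -
  let ?H = "hausdorff_borel d :: 'a measure" and ?C = "hausdorff_measure d :: 'a measure"
  have T[measurable]: "T \<in> borel \<rightarrow>\<^sub>M borel" unfolding T_def by measurable
  have T_H: "T \<in> ?H \<rightarrow>\<^sub>M ?H" using T by (simp cong: measurable_cong_sets)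
  have aff: "?H = density (distr ?H ?H T) (\<lambda>_. ennreal (h ^ d))"
    using hausdorff_borel_affine[OF \<open>h > 0\<close>, of d x] unfolding T_def by (simp cong: distr_cong)
  have pos: "0 < ennreal (h ^ d)" using \<open>h > 0\<close> by simp
  have dist_eq: "distr ?C ?H T = distr ?H ?H T"
    unfolding hausdorff_measure_eq by (rule distr_completion[OF T_H])
  \<comment> \<open>Scaling by the positive factor \<open>h ^ d\<close> leaves the null sets
    unchanged. This lets preimages of null sets be null, which measurability for the completion
    demands beyond Borel measurability.\<close>
  have "emeasure ?H A = 0 \<longleftrightarrow> emeasure (distr ?C ?H T) A = 0" if "A \<in> sets ?H" for A
  proof -
    have "emeasure ?H A = ennreal (h ^ d) * emeasure (distr ?H ?H T) A"
      using that by (subst aff) (simp add: emeasure_density nn_integral_cmult)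
    then show ?thesis using pos by (metis dist_eq less_irrefl mult_eq_0_iff)
  qed
  then have eq: "null_sets ?H = null_sets (distr ?C ?H T)"
    by (auto simp: null_sets_def)
  show T_C: "T \<in> ?C \<rightarrow>\<^sub>M ?C"
    using eq T_H unfolding hausdorff_measure_eq
    by (intro completion.measurable_completion2) (simp_all add: measurable_completion)
  have "?C = completion (density (distr ?H ?H T) (\<lambda>_. ennreal (h ^ d)))"
    unfolding hausdorff_measure_eq using aff by simp
  also have "\<dots> = density (completion (distr ?H ?H T)) (\<lambda>_. ennreal (h ^ d))"
    using pos by (intro completion_density_eq) auto
  also have "completion (distr ?H ?H T) = distr ?C ?C T"
    unfolding dist_eq[symmetric] using eq T_H unfolding hausdorff_measure_eq
    by (intro completion.completion_distr_eq) (simp_all add: measurable_completion)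
  finally show "?C = density (distr ?C ?C T) (\<lambda>_. ennreal (h ^ d))" .
qed

lemma integral_hausdorff_affine:
  fixes x :: "'a::euclidean_space" and f :: "'a \<Rightarrow> real"
  assumes "h > 0" and f: "f \<in> borel_measurable (hausdorff_measure d)"
  shows "integral\<^sup>L (hausdorff_measure d) f = h ^ d * (\<integral>y. f (x + h *\<^sub>R y) \<partial>hausdorff_measure d)"
proof -
  let ?T = "\<lambda>y. x + h *\<^sub>R y"
  let ?D = "distr (hausdorff_measure d) (hausdorff_measure d) ?T"
  have "integral\<^sup>L (hausdorff_measure d) f = integral\<^sup>L (density ?D (\<lambda>_. ennreal (h ^ d))) f"
    using hausdorff_measure_affine[OF \<open>h > 0\<close>, of d x] by simp
  also have "\<dots> = (\<integral>y. h ^ d *\<^sub>R f y \<partial>?D)"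
    using \<open>h > 0\<close> f by (intro integral_density) auto
  also have "\<dots> = h ^ d * (\<integral>y. f (?T y) \<partial>hausdorff_measure d)"
    using f by (subst integral_distr[OF hausdorff_affine_measurable[OF \<open>h > 0\<close>]]) auto
  finally show ?thesis .
qed

text \<open>A linear isometry of the model space onto \<open>T\<close> keeps Hausdorff outer
  measure, which in full dimension is Lebesgue measure. This turns the normalisation of the kernel
  into the limit constant 1 on every tangent space.\<close>

lemma integral_hausdorff_subspace:
  fixes T :: "'a::euclidean_space set" and k :: "real \<Rightarrow> real"
  assumes "subspace T" "dim T = DIM('b::euclidean_space)"
    and k: "(\<lambda>y::'a. k (norm y)) \<in> borel_measurable borel"
  shows "(LINT y:T|hausdorff_measure DIM('b). k (norm y)) = (\<integral>u. k (norm u) \<partial>(lborel :: 'b measure))"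
proof -
  let ?H = "hausdorff_borel DIM('b) :: 'a measure"
  obtain g :: "'b \<Rightarrow> 'a" where g: "linear g" "range g = T" "\<And>u. norm (g u) = norm u"
    by (rule isometries_subspaces[of "UNIV :: 'b set" T]) (simp_all add: assms that)
  have iso: "dist (g u) (g v) = 1 * dist u v" for u v
    using g(1,3) by (simp add: dist_norm linear_diff[symmetric])
  have gm [measurable]: "g \<in> borel \<rightarrow>\<^sub>M borel"
    using g(1) by (simp add: borel_measurable_continuous_onI linear_continuous_on linear_linear)
  have T [measurable]: "T \<in> sets borel" using assms(1) by (simp add: closed_subspace)
  have eq: "density ?H (indicator T) = distr lborel borel g"
  proof (rule measure_eqI)
    fix A assume "A \<in> sets (density ?H (indicator T))"
    then have A: "A \<in> sets borel" by simp
    have im: "T \<inter> A = g ` (g -` A)" using g(2) by auto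
    have pre: "g -` A \<in> sets borel" using measurable_sets[OF gm A] by simp
    have "emeasure (density ?H (indicator T)) A = emeasure ?H (T \<inter> A)"
      using A by (simp add: emeasure_density indicator_inter_arith[symmetric])
    also have "\<dots> = hausdorff_outer DIM('b) (T \<inter> A)"
      using A T by (intro emeasure_hausdorff_borel) auto
    also have "\<dots> = hausdorff_outer DIM('b) (g -` A)"
      unfolding im using hausdorff_outer_similarity_image[of 1 g "DIM('b)" "g -` A"] iso by simp
    also have "\<dots> = emeasure lborel (g -` A)"
      by (rule hausdorff_outer_eq_lborel[OF pre])
    also have "\<dots> = emeasure (distr lborel borel g) A"
      using A by (simp add: emeasure_distr)
    finally show "emeasure (density ?H (indicator T)) A = emeasure (distr lborel borel g) A" .
  qed simp
  have "(LINT y:T|hausdorff_measure DIM('b). k (norm y)) = (\<integral>y. indicator T y *\<^sub>R k (norm y) \<partial>?H)"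
    unfolding set_lebesgue_integral_def hausdorff_measure_eq
    using k T by (intro integral_completion) (simp add: measurable_cong_sets[OF sets_hausdorff_borel refl])
  also have "\<dots> = (\<integral>y. k (norm y) \<partial>density ?H (\<lambda>y. ennreal (indicator T y)))"
    using k T by (intro integral_density[symmetric]) (simp_all add: measurable_cong_sets[OF sets_hausdorff_borel refl])
  also have "density ?H (\<lambda>y. ennreal (indicator T y)) = distr lborel borel g"
    using eq by (simp add: ennreal_indicator)
  also have "(\<integral>y. k (norm y) \<partial>distr lborel borel g) = (\<integral>u. k (norm (g u)) \<partial>lborel)"
    using k by (intro integral_distr) auto
  finally show ?thesis by (simp add: g(3))
qed

section \<open>Mean squared error\<close>

text \<open>After centring, independence removes the cross terms. Each variance is bounded by the
  second moment \<open>s\<close>, which, unlike the variance, is directly an integral of the kind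
  that (A.2) controls.\<close>

lemma (in prob_space) mean_square_error_sum:
  fixes Y :: "nat \<Rightarrow> 'a \<Rightarrow> real"
  assumes indep: "indep_vars (\<lambda>_. borel) Y UNIV" and bdd: "\<And>i \<omega>. \<bar>Y i \<omega>\<bar> \<le> B"
    and mean: "\<And>i. expectation (Y i) = \<mu>" and second: "\<And>i. expectation (\<lambda>\<omega>. (Y i \<omega>)\<^sup>2) = s"
  shows "expectation (\<lambda>\<omega>. (a * (\<Sum>i<n. Y i \<omega>) - q)\<^sup>2) \<le> a\<^sup>2 * real n * s + (a * real n * \<mu> - q)\<^sup>2"
proof -
  define Z where "Z = (\<lambda>i \<omega>. Y i \<omega> - \<mu>)"
  have Ym [measurable]: "Y i \<in> borel_measurable M" for i
    using indep by (auto simp: indep_vars_def)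
  then have Zm [measurable]: "Z i \<in> borel_measurable M" for i by (simp add: Z_def)
  have int: "integrable M f" if "f \<in> borel_measurable M" "\<And>\<omega>. \<bar>f \<omega>\<bar> \<le> C" for f :: "'a \<Rightarrow> real" and C
    using that by (intro integrable_const_bound[of _ C]) auto
  have Yi: "integrable M (Y i)" for i by (rule int[OF Ym bdd])
  have Y2i: "integrable M (\<lambda>\<omega>. (Y i \<omega>)\<^sup>2)" for i
  proof (rule int)
    fix \<omega> show "\<bar>(Y i \<omega>)\<^sup>2\<bar> \<le> B\<^sup>2" using power_mono[OF bdd[of i \<omega>], of 2] by simp
  qed simp
  have Zi: "integrable M (Z i)" for i unfolding Z_def using Yi by simp
  have Zb: "\<bar>Z i \<omega>\<bar> \<le> B + \<bar>\<mu>\<bar>" for i \<omega> using bdd[of i \<omega>] by (auto simp: Z_def)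
  have Zm0: "expectation (Z i) = 0" for i
    unfolding Z_def using Yi mean by (simp add: prob_space)
  have Z2: "expectation (\<lambda>\<omega>. Z i \<omega> * Z i \<omega>) \<le> s" for i
  proof -
    have "expectation (\<lambda>\<omega>. Z i \<omega> * Z i \<omega>) = expectation (\<lambda>\<omega>. (Y i \<omega>)\<^sup>2 - 2 * \<mu> * Y i \<omega> + \<mu>\<^sup>2)"
      by (intro Bochner_Integration.integral_cong) (auto simp: Z_def power2_eq_square algebra_simps)
    also have "\<dots> = s - 2 * \<mu> * \<mu> + \<mu>\<^sup>2"
      using Yi Y2i by (simp add: mean second prob_space)
    finally show ?thesis by (simp add: power2_eq_square)
  qed
  have indepZ: "indep_vars (\<lambda>_. borel) Z UNIV"
    unfolding Z_def by (rule indep_vars_compose2[OF indep]) simp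
  have ZZi: "integrable M (\<lambda>\<omega>. Z i \<omega> * Z j \<omega>)" for i j
  proof (rule int)
    fix \<omega> show "\<bar>Z i \<omega> * Z j \<omega>\<bar> \<le> (B + \<bar>\<mu>\<bar>) * (B + \<bar>\<mu>\<bar>)"
      unfolding abs_mult by (intro mult_mono Zb) (use Zb[of i \<omega>] in auto)
  qed simp
  have ZZ: "expectation (\<lambda>\<omega>. Z i \<omega> * Z j \<omega>) = 0" if "i \<noteq> j" for i j
  proof -
    have "expectation (\<lambda>\<omega>. \<Prod>k\<in>{i, j}. Z k \<omega>) = (\<Prod>k\<in>{i, j}. expectation (Z k))"
      by (intro indep_vars_lebesgue_integral indep_vars_subset[OF indepZ] Zi) auto
    then show ?thesis using that by (simp add: Zm0)
  qed
  have sq: "(\<Sum>i<n. Z i \<omega>)\<^sup>2 = (\<Sum>i<n. \<Sum>j<n. Z i \<omega> * Z j \<omega>)" for \<omega>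
    by (simp add: power2_eq_square sum_product)
  have "expectation (\<lambda>\<omega>. (\<Sum>i<n. Z i \<omega>)\<^sup>2) = (\<Sum>i<n. \<Sum>j<n. expectation (\<lambda>\<omega>. Z i \<omega> * Z j \<omega>))"
    unfolding sq using ZZi by (simp add: Bochner_Integration.integral_sum)
  also have "\<dots> = (\<Sum>i<n. expectation (\<lambda>\<omega>. Z i \<omega> * Z i \<omega>))"
  proof (intro sum.cong refl)
    fix i assume "i \<in> {..<n}"
    then show "(\<Sum>j<n. expectation (\<lambda>\<omega>. Z i \<omega> * Z j \<omega>)) = expectation (\<lambda>\<omega>. Z i \<omega> * Z i \<omega>)"
      by (subst sum.remove[of _ i]) (auto intro!: sum.neutral ZZ)
  qed
  also have "\<dots> \<le> (\<Sum>i<n. s)" by (intro sum_mono Z2)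
  finally have var: "expectation (\<lambda>\<omega>. (\<Sum>i<n. Z i \<omega>)\<^sup>2) \<le> real n * s" by simp
  define r where "r = a * real n * \<mu> - q"
  have S2i: "integrable M (\<lambda>\<omega>. (\<Sum>i<n. Z i \<omega>)\<^sup>2)" unfolding sq using ZZi by simp
  have Si: "integrable M (\<lambda>\<omega>. \<Sum>i<n. Z i \<omega>)" using Zi by simp
  have "a * (\<Sum>i<n. Y i \<omega>) - q = a * (\<Sum>i<n. Z i \<omega>) + r" for \<omega>
    by (simp add: Z_def r_def sum_subtractf algebra_simps)
  then have "expectation (\<lambda>\<omega>. (a * (\<Sum>i<n. Y i \<omega>) - q)\<^sup>2)
      = expectation (\<lambda>\<omega>. a\<^sup>2 * (\<Sum>i<n. Z i \<omega>)\<^sup>2 + 2 * a * r * (\<Sum>i<n. Z i \<omega>) + r\<^sup>2)"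
    by (simp add: power2_sum power_mult_distrib ac_simps)
  also have "\<dots> = a\<^sup>2 * expectation (\<lambda>\<omega>. (\<Sum>i<n. Z i \<omega>)\<^sup>2) + 2 * a * r * expectation (\<lambda>\<omega>. \<Sum>i<n. Z i \<omega>) + r\<^sup>2"
    using S2i Si by (simp add: prob_space)
  also have "expectation (\<lambda>\<omega>. \<Sum>i<n. Z i \<omega>) = 0" using Zi by (simp add: Zm0)
  also have "a\<^sup>2 * expectation (\<lambda>\<omega>. (\<Sum>i<n. Z i \<omega>)\<^sup>2) + 2 * a * r * 0 + r\<^sup>2 \<le> a\<^sup>2 * (real n * s) + r\<^sup>2"
    using var by (simp add: mult_left_mono)
  finally show ?thesis by (simp add: r_def mult.assoc)
qed

section \<open>Kernels and their moments under the sampling law\<close>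

lemma kernel_bounded:
  fixes K :: "real \<Rightarrow> real"
  assumes "continuous_on {0..} K" and "\<forall>t>1. K t = 0"
  obtains B where "\<And>t. t \<ge> 0 \<Longrightarrow> \<bar>K t\<bar> \<le> B"
proof -
  have "bounded (K ` {0..1})"
    by (intro compact_imp_bounded compact_continuous_image continuous_on_subset[OF assms(1)]) auto
  then obtain B where B: "\<And>t. t \<in> {0..1} \<Longrightarrow> \<bar>K t\<bar> \<le> B"
    unfolding bounded_iff by (metis imageI real_norm_def)
  have "\<bar>K t\<bar> \<le> max B 0" if "t \<ge> 0" for t
    using B[of t] assms(2) that by (cases "t \<le> 1") auto
  then show ?thesis by (rule that)
qed

lemma kernel_norm_continuous:
  "continuous_on {0..} K \<Longrightarrow> continuous_on UNIV (\<lambda>y::'a::real_normed_vector. K (norm y))"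
  by (rule continuous_on_compose2) (auto intro: continuous_intros)

lemma kernel_norm_compactly_supported:
  assumes "\<forall>t>1. K t = 0"
  shows "compactly_supported (\<lambda>y::'a::euclidean_space. K (norm y))"
proof -
  have "{y::'a. K (norm y) \<noteq> 0} \<subseteq> cball 0 1"
    using assms by (auto simp: not_less[symmetric])
  then show ?thesis
    unfolding compactly_supported_def compact_closure by (rule bounded_subset[OF bounded_cball])
qed

text \<open>\<open>P\<close> lives on Borel sets, the density on the larger completed sigma-algebra.
  Pushing forward along the identity restricts the density measure to Borel sets and so identifies
  it with \<open>P\<close>.\<close>

lemma integral_density_hausdorff:
  fixes \<Omega> :: "'a::euclidean_space set" and G :: "'a \<Rightarrow> real"
  assumes \<Omega>: "\<Omega> \<in> sets (hausdorff_measure d)" and p: "p \<in> borel_measurable (hausdorff_measure d)"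
    and p_pos: "\<And>x. x \<in> \<Omega> \<Longrightarrow> p x > 0"
    and P_sets: "sets P = sets borel"
    and P_dens: "\<And>A. A \<in> sets borel \<Longrightarrow> emeasure P A = (\<integral>\<^sup>+x\<in>A \<inter> \<Omega>. ennreal (p x) \<partial>hausdorff_measure d)"
    and G: "G \<in> borel_measurable borel"
  shows "integral\<^sup>L P G = (\<integral>z. (indicator \<Omega> z * p z) * G z \<partial>hausdorff_measure d)"
proof -
  let ?H = "hausdorff_measure d :: 'a measure"
  let ?q = "\<lambda>z. indicator \<Omega> z * p z"
  have id: "(\<lambda>z. z) \<in> ?H \<rightarrow>\<^sub>M borel"
    unfolding hausdorff_measure_eq by (intro measurable_completion) (simp add: measurable_ident_sets)
  have GH: "G \<in> borel_measurable ?H" using measurable_compose[OF id G] by simp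
  have qm: "?q \<in> borel_measurable ?H" using \<Omega> p by measurable
  have "P = distr (density ?H (\<lambda>z. ennreal (?q z))) borel (\<lambda>z. z)"
  proof (rule measure_eqI)
    fix A assume "A \<in> sets P"
    then have A: "A \<in> sets borel" using P_sets by simp
    then have AH: "A \<in> sets ?H" using measurable_sets[OF id A] by (simp add: hausdorff_measure_eq)
    have "emeasure (distr (density ?H (\<lambda>z. ennreal (?q z))) borel (\<lambda>z. z)) A = emeasure (density ?H (\<lambda>z. ennreal (?q z))) A"
      using A id by (subst emeasure_distr) (auto simp: hausdorff_measure_eq)
    also have "\<dots> = (\<integral>\<^sup>+z. ennreal (?q z) * indicator A z \<partial>?H)"
      using qm AH by (intro emeasure_density) auto
    also have "\<dots> = emeasure P A"
      unfolding P_dens[OF A] by (intro nn_integral_cong) (auto split: split_indicator)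
    finally show "emeasure P A = emeasure (distr (density ?H (\<lambda>z. ennreal (?q z))) borel (\<lambda>z. z)) A" by simp
  qed (simp add: P_sets)
  then have "integral\<^sup>L P G = integral\<^sup>L (density ?H (\<lambda>z. ennreal (?q z))) G"
    using id G by (simp add: integral_distr)
  also have "\<dots> = (\<integral>z. ?q z *\<^sub>R G z \<partial>?H)"
    using p_pos by (intro integral_density GH qm AE_I2) (auto split: split_indicator intro: less_imp_le)
  finally show ?thesis by simp
qed

text \<open>Kept general in \<open>k\<close>, so that the first and the second moment of the
  rescaled kernel are both instances.\<close>

lemma integral_density_hausdorff_rescaled:
  fixes \<Omega> :: "'a::euclidean_space set" and k :: "real \<Rightarrow> real"
  assumes \<Omega>: "\<Omega> \<in> sets (hausdorff_measure d)" and p: "p \<in> borel_measurable (hausdorff_measure d)"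
    and p_pos: "\<And>x. x \<in> \<Omega> \<Longrightarrow> p x > 0"
    and P_sets: "sets P = sets borel"
    and P_dens: "\<And>A. A \<in> sets borel \<Longrightarrow> emeasure P A = (\<integral>\<^sup>+x\<in>A \<inter> \<Omega>. ennreal (p x) \<partial>hausdorff_measure d)"
    and k: "(\<lambda>y::'a. k (norm y)) \<in> borel_measurable borel" and h: "h > 0"
  shows "(\<integral>z. k (norm (z - x) / h) \<partial>P)
    = h ^ d * (LINT y:{y. x + h *\<^sub>R y \<in> \<Omega>}|hausdorff_measure d. k (norm y) * p (x + h *\<^sub>R y))"
proof -
  let ?H = "hausdorff_measure d :: 'a measure"
  \<comment> \<open>Measurability of \<open>k\<close> is known only through
    \<open>k (norm y)\<close>, so the division by \<open>h\<close> is moved inside the norm.\<close>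
  have norm_eq: "norm (z - x) / h = norm ((1 / h) *\<^sub>R (z - x))" for z using h by simp
  have G: "(\<lambda>z. k (norm (z - x) / h)) \<in> borel_measurable borel"
    unfolding norm_eq by (rule measurable_compose[OF _ k]) measurable
  have id: "(\<lambda>z. z) \<in> ?H \<rightarrow>\<^sub>M borel"
    unfolding hausdorff_measure_eq by (intro measurable_completion) (simp add: measurable_ident_sets)
  have meas: "(\<lambda>z. indicator \<Omega> z * p z * k (norm (z - x) / h)) \<in> borel_measurable ?H"
    using measurable_compose[OF id G] \<Omega> p by measurable
  have "(\<integral>z. k (norm (z - x) / h) \<partial>P) = (\<integral>z. indicator \<Omega> z * p z * k (norm (z - x) / h) \<partial>?H)"
    by (rule integral_density_hausdorff[OF \<Omega> p p_pos P_sets P_dens G])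
  also have "\<dots> = h ^ d * (\<integral>y. indicator \<Omega> (x + h *\<^sub>R y) * p (x + h *\<^sub>R y) * k (norm (x + h *\<^sub>R y - x) / h) \<partial>?H)"
    by (rule integral_hausdorff_affine[OF h meas])
  also have "(\<lambda>y. indicator \<Omega> (x + h *\<^sub>R y) * p (x + h *\<^sub>R y) * k (norm (x + h *\<^sub>R y - x) / h))
      = (\<lambda>y. indicator {y. x + h *\<^sub>R y \<in> \<Omega>} y *\<^sub>R (k (norm y) * p (x + h *\<^sub>R y)))"
    using h by (auto simp: fun_eq_iff split: split_indicator)
  finally show ?thesis by (simp add: set_lebesgue_integral_def)
qed

theorem theorem1p1:
  fixes \<Omega> :: "'a::euclidean_space set" and p :: "'a \<Rightarrow> real" and P :: "'a measure"
    and M :: "'w measure" and X :: "nat \<Rightarrow> 'w \<Rightarrow> 'a" and K :: "real \<Rightarrow> real"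
    and m c :: real
  assumes rect: "rectifiable TYPE('b::euclidean_space) \<Omega>"
    and \<Omega>_meas: "\<Omega> \<in> sets (hausdorff_measure DIM('b))"
    and p_meas: "p \<in> borel_measurable (hausdorff_measure DIM('b))"
    and p_pos: "\<forall>x\<in>\<Omega>. p x > 0"
    and P_prob: "prob_space P" and P_sets: "sets P = sets borel"
    and P_dens: "\<forall>A\<in>sets borel. emeasure P A =
                   (\<integral>\<^sup>+x\<in>A \<inter> \<Omega>. ennreal (p x) \<partial>hausdorff_measure DIM('b))"
    and M_prob: "prob_space M"
    and X_rv: "\<forall>i. X i \<in> borel_measurable M"
    and X_indep: "prob_space.indep_vars M (\<lambda>_. borel) X UNIV"
    and X_law: "\<forall>i. distr M borel (X i) = P"
    and K_cont: "continuous_on {0..} K"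
    and K_supp: "\<forall>t>1. K t = 0"
    and K_int: "integral\<^sup>L (lborel :: 'b measure) (\<lambda>u. K (norm u)) = 1"
    and m_pos: "m > 0"
    and A2: "AE x in hausdorff_measure DIM('b). x \<in> \<Omega> \<longrightarrow>
       (\<exists>T. approx_tangent_space DIM('b) \<Omega> p x T \<and>
          (\<forall>f :: 'a \<Rightarrow> real. continuous_on UNIV f \<and> compactly_supported f \<longrightarrow>
             (\<lambda>h. (LINT y:{y. x + h *\<^sub>R y \<in> \<Omega>}|hausdorff_measure DIM('b). f y * p (x + h *\<^sub>R y))
                 - p x * (LINT y:T|hausdorff_measure DIM('b). f y))
             \<in> O[at_right 0](\<lambda>h. h powr m)))"
    and c_pos: "c > 0"
  shows "AE x in hausdorff_measure DIM('b). x \<in> \<Omega> \<longrightarrow>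
    (\<lambda>n. prob_space.expectation M
       (\<lambda>\<omega>. (kde K (\<lambda>n. c * real n powr (-1 / (real DIM('b) + 2 * m))) DIM('b) X n x \<omega> - p x)\<^sup>2))
    \<in> O(\<lambda>n. real n powr (-2 * m / (real DIM('b) + 2 * m)))"
proof -
  interpret M: prob_space M by (rule M_prob)
  let ?d = "DIM('b)" and ?H = "hausdorff_measure DIM('b) :: 'a measure"
  define D where "D = real ?d + 2 * m"
  define h where "h = (\<lambda>n. c * real n powr (-1 / D))"
  \<comment> \<open>The squared kernel inherits continuity and support, so (A.2) may be applied to
    it without further assumptions.\<close>
  define K2 where "K2 = (\<lambda>t. (K t)\<^sup>2)"
  have D_pos: "D > 0" using m_pos by (simp add: D_def add_nonneg_pos)
  have K2_cont: "continuous_on {0..} K2" unfolding K2_def by (intro continuous_intros K_cont)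
  have K2_supp: "\<forall>t>1. K2 t = 0" using K_supp by (simp add: K2_def)
  \<comment> \<open>At \<open>n = 0\<close> the bandwidth is 0, since \<open>0 powr x = 0\<close>;
    all estimates below are for positive \<open>n\<close>.\<close>
  have h_pos: "h n > 0" if "n > 0" for n using that c_pos by (simp add: h_def)
  have h_lim: "filterlim h (at_right 0) sequentially"
  proof -
    have "(\<lambda>n. real n powr (-1 / D)) \<longlonglongrightarrow> 0"
      using D_pos by (intro tendsto_neg_powr filterlim_real_sequentially) auto
    then have "h \<longlonglongrightarrow> 0" unfolding h_def by (rule tendsto_mult_right_zero)
    moreover have "eventually (\<lambda>n. h n \<in> {0<..} \<and> h n \<noteq> 0) sequentially"
      using eventually_gt_at_top[of 0]
    proof eventually_elim
      case (elim n)
      then show ?case using h_pos[of n] by simp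
    qed
    ultimately show ?thesis by (simp add: filterlim_at)
  qed
  have h_bias: "(\<lambda>n. (h n powr m)\<^sup>2) \<in> O(\<lambda>n. real n powr (-2 * m / D))"
  proof (rule bigoI)
    show "eventually (\<lambda>n. norm ((h n powr m)\<^sup>2) \<le> c powr (2 * m) * norm (real n powr (-2 * m / D))) sequentially"
      using eventually_gt_at_top[of 0]
    proof eventually_elim
      case (elim n)
      have "(h n powr m)\<^sup>2 = h n powr (2 * m)"
        by (simp add: power2_eq_square powr_add[symmetric])
      also have "\<dots> = c powr (2 * m) * real n powr (-2 * m / D)"
        unfolding h_def using c_pos elim by (simp add: powr_mult powr_powr)
      finally show ?case by simp
    qed
  qed
  have h_var: "(\<lambda>n. 1 / (real n * h n ^ ?d)) \<in> O(\<lambda>n. real n powr (-2 * m / D))"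
  proof (rule bigoI)
    show "eventually (\<lambda>n. norm (1 / (real n * h n ^ ?d)) \<le> 1 / c ^ ?d * norm (real n powr (-2 * m / D))) sequentially"
      using eventually_gt_at_top[of 0]
    proof eventually_elim
      case (elim n)
      have "real n * h n ^ ?d = c ^ ?d * (real n powr 1 * real n powr (-1 / D * real ?d))"
      proof -
        have "real n powr (-1 / D * real ?d) = (real n powr (-1 / D)) powr real ?d"
          by (rule powr_powr[symmetric])
        also have "\<dots> = (real n powr (-1 / D)) ^ ?d"
          using elim by (intro powr_realpow) simp
        finally show ?thesis using elim unfolding h_def power_mult_distrib by simp
      qed
      also have "\<dots> = c ^ ?d * real n powr (2 * m / D)"
      proof -
        \<comment> \<open>With \<open>D = d + 2 m\<close> this exponent makes the variance factor
          \<open>1 / (n h^d)\<close> of the same order as the squared bias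
          \<open>h^(2m)\<close>.\<close>
        have "1 + -1 / D * real ?d = 2 * m / D" using D_pos by (simp add: field_simps D_def)
        then show ?thesis by (simp only: powr_add[symmetric])
      qed
      finally show ?case using c_pos elim by (simp add: powr_minus_divide)
    qed
  qed
  show ?thesis
    using A2
  proof eventually_elim
    case (elim x)
    show ?case
    proof
      assume "x \<in> \<Omega>"
      define I where "I = (\<lambda>k t. LINT y:{y. x + t *\<^sub>R y \<in> \<Omega>}|?H. k (norm y) * p (x + t *\<^sub>R y))"
      obtain T where T: "approx_tangent_space ?d \<Omega> p x T"
        and rate: "\<And>f :: 'a \<Rightarrow> real. continuous_on UNIV f \<Longrightarrow> compactly_supported f \<Longrightarrow>
             (\<lambda>t. (LINT y:{y. x + t *\<^sub>R y \<in> \<Omega>}|?H. f y * p (x + t *\<^sub>R y)) - p x * (LINT y:T|?H. f y))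
             \<in> O[at_right 0](\<lambda>t. t powr m)"
        using elim \<open>x \<in> \<Omega>\<close> by blast
      have I_rate: "(\<lambda>t. I k t - p x * (LINT y:T|?H. k (norm y))) \<in> O[at_right 0](\<lambda>t. t powr m)"
        if "continuous_on {0..} k" "\<forall>t>1. k t = 0" for k
        unfolding I_def using that
        by (intro rate kernel_norm_continuous kernel_norm_compactly_supported)
      have K_meas: "(\<lambda>y::'a. k (norm y)) \<in> borel_measurable borel" if "continuous_on {0..} k" for k
        using kernel_norm_continuous[OF that] by (rule borel_measurable_continuous_onI)
      have "(LINT y:T|?H. K (norm y)) = 1"
        using T K_int unfolding approx_tangent_space_def
        by (subst integral_hausdorff_subspace[where 'b='b]) (auto intro: K_meas K_cont)
      then have bias: "(\<lambda>t. I K t - p x) \<in> O[at_right 0](\<lambda>t. t powr m)"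
        using I_rate[OF K_cont K_supp] by simp
      \<comment> \<open>The variance needs only boundedness of the second moment integral, so its
        rate is weakened to \<open>O(1)\<close>.\<close>
      have "eventually (\<lambda>t::real. norm (t powr m) \<le> 1 * norm (1::real)) (at_right 0)"
        using eventually_at_right_real[of 0 1, OF zero_less_one]
      proof eventually_elim
        case (elim t)
        then show ?case using m_pos powr_mono2[of m t 1] by simp
      qed
      then have "(\<lambda>t::real. t powr m) \<in> O[at_right 0](\<lambda>_. 1 :: real)" by (rule bigoI)
      then have "(\<lambda>t. I K2 t - p x * (LINT y:T|?H. K2 (norm y))) \<in> O[at_right 0](\<lambda>_. 1)"
        using I_rate[OF K2_cont K2_supp] landau_o.big_trans by blast
      then have "(\<lambda>t. (I K2 t - p x * (LINT y:T|?H. K2 (norm y))) + p x * (LINT y:T|?H. K2 (norm y))) \<in> O[at_right 0](\<lambda>_. 1)"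
        by (rule sum_in_bigo) simp
      then have second: "I K2 \<in> O[at_right 0](\<lambda>_. 1)" by simp
      have bias': "(\<lambda>n. (I K (h n) - p x)\<^sup>2) \<in> O(\<lambda>n. real n powr (-2 * m / D))"
        using landau_o.big_power[OF landau_o.big.compose[OF bias h_lim], of 2] h_bias
        by (rule landau_o.big_trans)
      have var': "(\<lambda>n. I K2 (h n) * (1 / (real n * h n ^ ?d))) \<in> O(\<lambda>n. real n powr (-2 * m / D))"
        using landau_o.big.mult[OF landau_o.big.compose[OF second h_lim] h_var] by simp
      have P_int: "(\<integral>z. k (norm (z - x) / t) \<partial>P) = t ^ ?d * I k t" if "continuous_on {0..} k" "t > 0" for k t
        unfolding I_def
        by (rule integral_density_hausdorff_rescaled[OF \<Omega>_meas p_meas _ P_sets])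
           (use p_pos P_dens K_meas that in auto)
      have mse: "M.expectation (\<lambda>\<omega>. (kde K h ?d X n x \<omega> - p x)\<^sup>2)
          \<le> I K2 (h n) * (1 / (real n * h n ^ ?d)) + (I K (h n) - p x)\<^sup>2" if n: "n > 0" for n
      proof -
        define G where "G = (\<lambda>z::'a. K (norm (z - x) / h n))"
        have "(\<lambda>z. K (norm (z - x) / h n)) = (\<lambda>z. K (norm ((1 / h n) *\<^sub>R (z - x))))"
          using h_pos[OF n] by simp
        then have G: "G \<in> borel_measurable borel"
          unfolding G_def by (simp only:) (rule measurable_compose[OF _ K_meas[OF K_cont]], measurable)
        obtain B where B: "\<And>t. t \<ge> 0 \<Longrightarrow> \<bar>K t\<bar> \<le> B" using kernel_bounded[OF K_cont K_supp] by blast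
        have law: "M.expectation (\<lambda>\<omega>. F (X i \<omega>)) = integral\<^sup>L P F" if "F \<in> borel_measurable borel" for F :: "'a \<Rightarrow> real" and i
          using integral_distr[of "X i" M borel F] X_rv X_law that by simp
        have 1: "M.expectation (\<lambda>\<omega>. G (X i \<omega>)) = h n ^ ?d * I K (h n)" for i
          using law[OF G, of i] P_int[OF K_cont h_pos[OF n]] by (simp add: G_def)
        have 2: "M.expectation (\<lambda>\<omega>. (G (X i \<omega>))\<^sup>2) = h n ^ ?d * I K2 (h n)" for i
        proof -
          have "M.expectation (\<lambda>\<omega>. (G (X i \<omega>))\<^sup>2) = (\<integral>z. (G z)\<^sup>2 \<partial>P)"
            by (rule law) (use G in measurable)
          also have "\<dots> = h n ^ ?d * I K2 (h n)"
            using P_int[OF K2_cont h_pos[OF n]] by (simp add: G_def K2_def)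
          finally show ?thesis .
        qed
        \<comment> \<open>The prefactor \<open>1 / (n h^d)\<close> cancels \<open>n h^d\<close> in
          the mean, leaving \<open>I K (h n) - p x\<close> as bias. In the variance term its square
          meets only one such factor, and one copy of \<open>1 / (n h^d)\<close> survives.\<close>
        have "M.expectation (\<lambda>\<omega>. (1 / (real n * h n ^ ?d) * (\<Sum>i<n. G (X i \<omega>)) - p x)\<^sup>2)
          \<le> (1 / (real n * h n ^ ?d))\<^sup>2 * real n * (h n ^ ?d * I K2 (h n))
            + (1 / (real n * h n ^ ?d) * real n * (h n ^ ?d * I K (h n)) - p x)\<^sup>2"
        proof (rule M.mean_square_error_sum[OF _ _ 1 2])
          show "M.indep_vars (\<lambda>_. borel) (\<lambda>i \<omega>. G (X i \<omega>)) UNIV"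
            by (rule M.indep_vars_compose2[OF X_indep]) (use G in auto)
          show "\<bar>G (X i \<omega>)\<bar> \<le> B" for i \<omega>
            unfolding G_def using h_pos[OF n] by (intro B) simp
        qed
        then show ?thesis
          using n h_pos[OF n] by (simp add: kde_def G_def power2_eq_square)
      qed
      have "(\<lambda>n. M.expectation (\<lambda>\<omega>. (kde K h ?d X n x \<omega> - p x)\<^sup>2))
          \<in> O(\<lambda>n. I K2 (h n) * (1 / (real n * h n ^ ?d)) + (I K (h n) - p x)\<^sup>2)"
      proof (rule bigoI)
        show "eventually (\<lambda>n. norm (M.expectation (\<lambda>\<omega>. (kde K h ?d X n x \<omega> - p x)\<^sup>2))
          \<le> 1 * norm (I K2 (h n) * (1 / (real n * h n ^ ?d)) + (I K (h n) - p x)\<^sup>2)) sequentially"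
          using eventually_gt_at_top[of 0]
        proof eventually_elim
          case (elim n)
          have "norm a \<le> 1 * norm b" if "0 \<le> a" "a \<le> b" for a b :: real using that by simp
          then show ?case using mse[OF elim] by simp
        qed
      qed
      also have "(\<lambda>n. I K2 (h n) * (1 / (real n * h n ^ ?d)) + (I K (h n) - p x)\<^sup>2)
          \<in> O(\<lambda>n. real n powr (-2 * m / D))"
        by (rule sum_in_bigo[OF var' bias'])
      finally show "(\<lambda>n. M.expectation (\<lambda>\<omega>. (kde K (\<lambda>n. c * real n powr (-1 / (real ?d + 2 * m))) ?d X n x \<omega> - p x)\<^sup>2))
          \<in> O(\<lambda>n. real n powr (-2 * m / (real ?d + 2 * m)))"
        by (simp only: h_def D_def)
    qed
  qed
qed

end
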